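(* Let $k$ be an autoconvolution kernel as in the context, let $g^\dagger\in L^2_{\mathbb C}([0,2])$, and let $u^\dagger\in L^2_{\mathbb C}([0,1])$ be a norm-minimizing solution of the kernel-based deautoconvolution problem $\mathcal A_k[u]=g^\dagger$. Then the source condition $$\exists\,\psi\in L^2_{\mathbb C}([0,2]):\quad(0,\breve{\mathcal A}_k^*\psi)\in\partial_\beta\|\cdot\|^2(u^\dagger)$$ is fulfilled if and only if there exists $\phi\in L^2_{\mathbb C}([0,2])$ such that $$\|\Phi_{\mathcal I_k^*[\phi]}\|=1\qquad\text{and}\qquad\Phi_{\mathcal I_k^*[\phi]}[u^\dagger]=u^\dagger$$ for the integral operator $\Phi_{\mathcal I_k^*[\phi]}\colon L^2_{\mathbb C}([0,1])\to L^2_{\mathbb C}([0,1])$, $$\Phi_{\mathcal I_k^*[\phi]}[u](t):=\int_0^1\overline{k(s,s+t)}\,\phi(s+t)\,\overline{u(s)}\,\mathrm ds\qquad(t\in[0,1]).$$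
   Context: $L^2_{\mathbb C}([0,1])$ and $L^2_{\mathbb C}([0,2])$ denote the complex-valued square-integrable functions, regarded as real Hilbert spaces with inner product $\langle\cdot,\cdot\rangle_{\mathbb R}=\operatorname{Re}\langle\cdot,\cdot\rangle_{\mathbb C}$; functions are extended by zero outside their interval. Kernel: $k\in L^\infty_{\mathbb C}([0,1]\times[0,2])$ with $\operatorname{supp}k\subset\{(s,t):0\le s\le1,\ s\le t\le s+1\}$ and $k(s,t)=k(t-s,t)$ for $0\le s\le1$, $s\le t\le s+1$. The kernel-based autoconvolution is $\mathcal A_k\colon L^2_{\mathbb C}([0,1])\to L^2_{\mathbb C}([0,2])$, $\mathcal A_k[u](t)=\int_{-\infty}^\infty k(s,t)\,u(s)\,u(t-s)\,\mathrm ds$. A norm-minimizing solution of $\mathcal A_k[u]=g^\dagger$ is a solution $u^\dagger$ with $\|u^\dagger\|\le\|u\|$ for all solutions $u$. The subscript $\mathcal I_k^*[\phi]$ denotes the function $(s,t)\mapsto\overline{k(s,s+t)}\,\phi(s+t)$ on $[0,1]^2$, and $\|\Phi_{\mathcal I_k^*[\phi]}\|$ is the operator norm. For a real Banach space $X$, $X\otimes_{\pi,\mathrm{sym}}X$ is the closed subspace of the projective tensor product $X\otimes_\pi X$ spanned by the tensors $u\otimes u$. With $X=L^2_{\mathbb C}([0,1])$ (as a real space), $\breve{\mathcal A}_k\colon X\otimes_{\pi,\mathrm{sym}}X\to L^2_{\mathbb C}([0,2])$ is the unique bounded ($\mathbb R$-)linear map with $\breve{\mathcal A}_k[u\otimes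 u]=\mathcal A_k[u]$ for all $u$, and $\breve{\mathcal A}_k^*\colon L^2_{\mathbb C}([0,2])\to(X\otimes_{\pi,\mathrm{sym}}X)^*$ is its adjoint. The dilinear subdifferential $\partial_\beta F(u)$ of $F\colon X\to\overline{\mathbb R}$ is the set of all $(\xi,\Xi)\in X^*\times(X\otimes_{\pi,\mathrm{sym}}X)^*$ such that $F(u)$ is finite and $F(v)\ge F(u)+\langle\xi,v-u\rangle+\langle\Xi,v\otimes v-u\otimes u\rangle$ for all $v\in X$. Here $F=\|\cdot\|^2$ is the squared norm of $L^2_{\mathbb C}([0,1])$.
   Formalization: The kernel k is additionally assumed not to vanish almost everywhere; for k = 0 (so g† = 0, u† = 0) the source condition holds with ψ = 0 while every Φ is the zero operator, so the stated equivalence fails. *)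

theory Defs
  imports "HOL-Analysis.Analysis"
begin

section \<open>The real Hilbert spaces of complex square-integrable functions\<close>

text \<open>
  The type \<open>'n L2\<close> consists of the a.e.-classes of Lebesgue-measurable square-integrable functions
  \<open>f :: real \<Rightarrow> complex\<close> on the interval from \<open>0\<close> to \<open>CARD('n)\<close>. With the numeral types,
  \<open>1 L2\<close> is the space over \<open>[0,1]\<close> and \<open>2 L2\<close> the space over \<open>[0,2]\<close>.
  The inner product is the real part of the complex one. The type is set up by hand because
  \<open>quotient_type\<close> does not accept a relation that depends on a phantom type.
\<close>

definition L2_measure :: "'n itself \<Rightarrow> real measure" where
  "L2_measure _ = lebesgue_on {0..real CARD('n)}"

definition sq_integrable :: "'a measure \<Rightarrow> ('a \<Rightarrow> complex) \<Rightarrow> bool" where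
  "sq_integrable M f \<longleftrightarrow> f \<in> borel_measurable M \<and> integrable M (\<lambda>x. (cmod (f x))\<^sup>2)"

lemma sq_integrable_mult:
  assumes "sq_integrable M f" "sq_integrable M g"
  shows "integrable M (\<lambda>x. f x * cnj (g x))"
proof (rule Bochner_Integration.integrable_bound)
  show "integrable M (\<lambda>x. (cmod (f x))\<^sup>2 + (cmod (g x))\<^sup>2)"
    using assms by (auto simp: sq_integrable_def)
  have [measurable]: "f \<in> borel_measurable M" "g \<in> borel_measurable M"
    using assms by (auto simp: sq_integrable_def)
  have [measurable]: "cnj \<in> borel_measurable borel"
    by (intro borel_measurable_continuous_onI continuous_intros)
  show "(\<lambda>x. f x * cnj (g x)) \<in> borel_measurable M" by measurable
  have "a * b \<le> a\<^sup>2 + b\<^sup>2" if "0 \<le> a" "0 \<le> b" for a b :: real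
    using sum_squares_bound[of a b] that mult_nonneg_nonneg[of a b] by linarith
  then show "AE x in M. norm (f x * cnj (g x)) \<le> norm ((cmod (f x))\<^sup>2 + (cmod (g x))\<^sup>2)"
    by (intro AE_I2) (simp add: norm_mult)
qed

lemma sq_integrable_add:
  assumes "sq_integrable M f" "sq_integrable M g"
  shows "sq_integrable M (\<lambda>x. f x + g x)"
  unfolding sq_integrable_def
proof (intro conjI)
  show [measurable]: "(\<lambda>x. f x + g x) \<in> borel_measurable M"
    using assms by (auto simp: sq_integrable_def)
  show "integrable M (\<lambda>x. (cmod (f x + g x))\<^sup>2)"
  proof (rule Bochner_Integration.integrable_bound)
    show "integrable M (\<lambda>x. 2 * (cmod (f x))\<^sup>2 + 2 * (cmod (g x))\<^sup>2)"
      using assms by (auto simp: sq_integrable_def)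
    have "(cmod (a + b))\<^sup>2 \<le> 2 * (cmod a)\<^sup>2 + 2 * (cmod b)\<^sup>2" for a b
      using power_mono[OF norm_triangle_ineq[of a b], of 2] sum_squares_bound[of "cmod a" "cmod b"]
      by (simp add: power2_sum)
    then show "AE x in M. norm ((cmod (f x + g x))\<^sup>2) \<le> norm (2 * (cmod (f x))\<^sup>2 + 2 * (cmod (g x))\<^sup>2)"
      by simp
  qed measurable
qed

lemma sq_integrable_scaleR: "sq_integrable M f \<Longrightarrow> sq_integrable M (\<lambda>x. c *\<^sub>R f x)"
proof -
  assume f: "sq_integrable M f"
  then have [measurable]: "f \<in> borel_measurable M" by (simp add: sq_integrable_def)
  have "integrable M (\<lambda>x. c\<^sup>2 * (cmod (f x))\<^sup>2)"
    using f by (intro integrable_mult_right) (simp add: sq_integrable_def)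
  then show ?thesis
    by (simp add: sq_integrable_def power_mult_distrib)
qed

lemma sq_integrable_zero: "sq_integrable M (\<lambda>_. 0)"
  by (simp add: sq_integrable_def)

definition L2_rel :: "'n itself \<Rightarrow> (real \<Rightarrow> complex) \<Rightarrow> (real \<Rightarrow> complex) \<Rightarrow> bool" where
  "L2_rel i f g \<longleftrightarrow> sq_integrable (L2_measure i) f \<and> sq_integrable (L2_measure i) g
     \<and> (AE x in L2_measure i. f x = g x)"

lemma L2_rel_part_equivp: "part_equivp (L2_rel i)"
proof (rule part_equivpI)
  show "\<exists>x. L2_rel i x x"
    by (rule exI[of _ "\<lambda>_. 0"]) (simp add: L2_rel_def sq_integrable_zero)
  show "symp (L2_rel i)"
  proof (rule sympI)
    fix f g assume fg: "L2_rel i f g"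
    then have "AE x in L2_measure i. f x = g x" by (simp add: L2_rel_def)
    then have "AE x in L2_measure i. g x = f x" by eventually_elim simp
    then show "L2_rel i g f"
      using fg by (simp add: L2_rel_def)
  qed
  show "transp (L2_rel i)"
  proof (rule transpI)
    fix f g h assume fg: "L2_rel i f g" and gh: "L2_rel i g h"
    have "AE x in L2_measure i. f x = g x" "AE x in L2_measure i. g x = h x"
      using fg gh by (simp_all add: L2_rel_def)
    then have "AE x in L2_measure i. f x = h x"
      by eventually_elim simp
    then show "L2_rel i f h"
      using fg gh by (simp add: L2_rel_def)
  qed
qed

typedef 'n L2 = "{C. \<exists>f. L2_rel TYPE('n) f f \<and> C = Collect (L2_rel TYPE('n) f)}"
proof -
  have "L2_rel TYPE('n) (\<lambda>_. 0) (\<lambda>_. 0)"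
    by (simp add: L2_rel_def sq_integrable_zero)
  then show ?thesis by blast
qed

text \<open>\<open>L2_of f\<close> is the class of \<open>f\<close>; it is meaningful only for square-integrable \<open>f\<close>.\<close>

definition L2_of :: "(real \<Rightarrow> complex) \<Rightarrow> 'n L2" where
  "L2_of f = Abs_L2 (Collect (L2_rel TYPE('n) f))"

definition L2_rep :: "'n L2 \<Rightarrow> real \<Rightarrow> complex" where
  "L2_rep u = (SOME f. f \<in> Rep_L2 u)"

definition cr_L2' :: "(real \<Rightarrow> complex) \<Rightarrow> 'n L2 \<Rightarrow> bool" where
  "cr_L2' f u \<longleftrightarrow> L2_rel TYPE('n) f f \<and> L2_of f = u"

lemma Quotient3_L2: "Quotient3 (L2_rel TYPE('n)) (L2_of :: _ \<Rightarrow> 'n L2) L2_rep"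
proof -
  interpret quot_type "L2_rel TYPE('n)" "Abs_L2 :: _ \<Rightarrow> 'n L2" Rep_L2
  proof
    show "part_equivp (L2_rel TYPE('n))" by (rule L2_rel_part_equivp)
    show "\<exists>x. L2_rel TYPE('n) x x \<and> Rep_L2 y = Collect (L2_rel TYPE('n) x)" for y :: "'n L2"
      using Rep_L2[of y] by simp
    show "Abs_L2 (Rep_L2 u) = u" for u :: "'n L2" by (rule Rep_L2_inverse)
    show "Rep_L2 (Abs_L2 C :: 'n L2) = C"
      if "\<exists>x. L2_rel TYPE('n) x x \<and> C = Collect (L2_rel TYPE('n) x)" for C
      using that by (intro Abs_L2_inverse) simp
    show "Rep_L2 u = Rep_L2 v \<longleftrightarrow> u = v" for u v :: "'n L2" by (rule Rep_L2_inject)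
  qed
  have "abs = (L2_of :: _ \<Rightarrow> 'n L2)" "rep = (L2_rep :: 'n L2 \<Rightarrow> _)"
    by (simp_all add: fun_eq_iff abs_def L2_of_def rep_def L2_rep_def)
  with Quotient show ?thesis by simp
qed

lemma Quotient_L2: "Quotient (L2_rel TYPE('n)) (L2_of :: _ \<Rightarrow> 'n L2) L2_rep cr_L2'"
  by (rule Quotient3_to_Quotient[OF Quotient3_L2]) (rule eq_reflection, simp add: cr_L2'_def fun_eq_iff)

setup_lifting Quotient_L2

instantiation L2 :: (type) real_inner
begin

lift_definition zero_L2 :: "'a L2" is "\<lambda>_. 0"
  by (simp add: L2_rel_def sq_integrable_zero)

lift_definition plus_L2 :: "'a L2 \<Rightarrow> 'a L2 \<Rightarrow> 'a L2" is "\<lambda>f g x. f x + g x"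
proof -
  fix f f' g g' assume f: "L2_rel TYPE('a) f f'" and g: "L2_rel TYPE('a) g g'"
  have "AE x in L2_measure TYPE('a). f x = f' x" "AE x in L2_measure TYPE('a). g x = g' x"
    using f g by (simp_all add: L2_rel_def)
  then have "AE x in L2_measure TYPE('a). f x + g x = f' x + g' x"
    by eventually_elim simp
  then show "L2_rel TYPE('a) (\<lambda>x. f x + g x) (\<lambda>x. f' x + g' x)"
    using f g by (simp add: L2_rel_def sq_integrable_add)
qed

lift_definition scaleR_L2 :: "real \<Rightarrow> 'a L2 \<Rightarrow> 'a L2" is "\<lambda>c f x. c *\<^sub>R f x"
proof -
  fix c :: real and f f' assume f: "L2_rel TYPE('a) f f'"
  then have "AE x in L2_measure TYPE('a). f x = f' x"
    by (simp add: L2_rel_def)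
  then have "AE x in L2_measure TYPE('a). c *\<^sub>R f x = c *\<^sub>R f' x"
    by eventually_elim simp
  then show "L2_rel TYPE('a) (\<lambda>x. c *\<^sub>R f x) (\<lambda>x. c *\<^sub>R f' x)"
    using f by (simp only: L2_rel_def sq_integrable_scaleR simp_thms)
qed

definition uminus_L2 :: "'a L2 \<Rightarrow> 'a L2" where "uminus_L2 u = (-1) *\<^sub>R u"
definition minus_L2 :: "'a L2 \<Rightarrow> 'a L2 \<Rightarrow> 'a L2" where "minus_L2 u v = u + (-1) *\<^sub>R (v :: 'a L2)"

lift_definition inner_L2 :: "'a L2 \<Rightarrow> 'a L2 \<Rightarrow> real" is
  "\<lambda>f g. Re (\<integral>x. f x * cnj (g x) \<partial>L2_measure TYPE('a))"
proof -
  fix f f' g g' assume f: "L2_rel TYPE('a) f f'" and g: "L2_rel TYPE('a) g g'"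
  let ?M = "L2_measure TYPE('a)"
  have "AE x in ?M. f x = f' x" "AE x in ?M. g x = g' x"
    using f g by (simp_all add: L2_rel_def)
  then have "AE x in ?M. f x * cnj (g x) = f' x * cnj (g' x)"
    by eventually_elim simp
  moreover have "integrable ?M (\<lambda>x. f x * cnj (g x))" "integrable ?M (\<lambda>x. f' x * cnj (g' x))"
    using f g by (simp_all add: L2_rel_def sq_integrable_mult)
  ultimately show "Re (\<integral>x. f x * cnj (g x) \<partial>?M) = Re (\<integral>x. f' x * cnj (g' x) \<partial>?M)"
    by (intro arg_cong[of _ _ Re] integral_cong_AE borel_measurable_integrable)
qed

definition norm_L2 :: "'a L2 \<Rightarrow> real" where "norm_L2 u = sqrt (inner u u)"
definition dist_L2 :: "'a L2 \<Rightarrow> 'a L2 \<Rightarrow> real" where "dist_L2 u v = norm (u - v)"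
definition sgn_L2 :: "'a L2 \<Rightarrow> 'a L2" where "sgn_L2 u = scaleR (inverse (norm u)) u"
definition uniformity_L2 :: "('a L2 \<times> 'a L2) filter" where
  "uniformity_L2 = (INF e\<in>{0 <..}. principal {(u, v :: 'a L2). dist u v < e})"
definition open_L2 :: "'a L2 set \<Rightarrow> bool" where
  "open_L2 S = (\<forall>u\<in>S. \<forall>\<^sub>F (u', v) in uniformity. u' = u \<longrightarrow> v \<in> S)"

instance
proof
  fix a b :: real and u v w :: "'a L2" and U :: "'a L2 set"
  show "u + v + w = u + (v + w)" by transfer (auto simp: L2_rel_def add.assoc intro!: sq_integrable_add)
  show "u + v = v + u" by transfer (auto simp: L2_rel_def add.commute intro!: sq_integrable_add)
  show "0 + u = u" by transfer (auto simp: L2_rel_def)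
  show "- u + u = 0" unfolding uminus_L2_def
  proof transfer
    fix f :: "real \<Rightarrow> complex" assume f: "L2_rel TYPE('a) f f"
    have "sq_integrable (L2_measure TYPE('a)) (\<lambda>x. -1 *\<^sub>R f x + f x)"
      using f by (intro sq_integrable_add sq_integrable_scaleR) (simp_all add: L2_rel_def)
    then show "L2_rel TYPE('a) (\<lambda>x. -1 *\<^sub>R f x + f x) (\<lambda>_. 0)"
      by (simp add: L2_rel_def sq_integrable_zero)
  qed
  show "u - v = u + - v" by (simp add: minus_L2_def uminus_L2_def)
  show "a *\<^sub>R (u + v) = a *\<^sub>R u + a *\<^sub>R v"
    by transfer (auto simp: L2_rel_def scaleR_add_right intro!: sq_integrable_add sq_integrable_scaleR)
  show "(a + b) *\<^sub>R u = a *\<^sub>R u + b *\<^sub>R u"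
    by transfer (auto simp: L2_rel_def scaleR_add_left intro!: sq_integrable_add sq_integrable_scaleR)
  show "a *\<^sub>R b *\<^sub>R u = (a * b) *\<^sub>R u"
    by transfer (auto simp: L2_rel_def intro!: sq_integrable_scaleR)
  show "1 *\<^sub>R u = u" by transfer (auto simp: L2_rel_def)
  show "dist u v = norm (u - v)" by (rule dist_L2_def)
  show "sgn u = scaleR (inverse (norm u)) u" by (rule sgn_L2_def)
  show "(uniformity :: ('a L2 \<times> 'a L2) filter) = (INF e\<in>{0 <..}. principal {(u, v). dist u v < e})"
    by (rule uniformity_L2_def)
  show "open U = (\<forall>u\<in>U. \<forall>\<^sub>F (u', v) in uniformity. u' = u \<longrightarrow> v \<in> U)" by (rule open_L2_def)
  show "norm u = sqrt (inner u u)" by (rule norm_L2_def)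
  show "inner u v = inner v u"
  proof transfer
    fix f g assume "L2_rel TYPE('a) f f" "L2_rel TYPE('a) g g"
    have "(\<integral>x. g x * cnj (f x) \<partial>L2_measure TYPE('a)) = (\<integral>x. cnj (f x * cnj (g x)) \<partial>L2_measure TYPE('a))"
      by (simp add: mult.commute)
    also have "\<dots> = cnj (\<integral>x. f x * cnj (g x) \<partial>L2_measure TYPE('a))"
      by (rule Bochner_Integration.integral_cnj)
    finally show "Re (\<integral>x. f x * cnj (g x) \<partial>L2_measure TYPE('a)) = Re (\<integral>x. g x * cnj (f x) \<partial>L2_measure TYPE('a))"
      by simp
  qed
  show "inner (u + v) w = inner u w + inner v w"
    by transfer (simp add: distrib_right L2_rel_def sq_integrable_mult)
  show "inner (a *\<^sub>R u) v = a * inner u v"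
    by transfer simp
  have sq: "Re (\<integral>x. f x * cnj (f x) \<partial>L2_measure TYPE('a)) = (\<integral>x. (cmod (f x))\<^sup>2 \<partial>L2_measure TYPE('a))"
    if "L2_rel TYPE('a) f f" for f
  proof -
    have "(\<integral>x. f x * cnj (f x) \<partial>L2_measure TYPE('a)) = (\<integral>x. complex_of_real ((cmod (f x))\<^sup>2) \<partial>L2_measure TYPE('a))"
      by (intro Bochner_Integration.integral_cong refl) (simp add: complex_norm_square del: of_real_power)
    then show ?thesis by (simp del: of_real_power)
  qed
  show "0 \<le> inner u u" by transfer (simp add: sq)
  show "(inner u u = 0) = (u = 0)"
  proof transfer
    fix f assume f: "L2_rel TYPE('a) f f"
    then show "(Re (\<integral>x. f x * cnj (f x) \<partial>L2_measure TYPE('a)) = 0) = L2_rel TYPE('a) f (\<lambda>_. 0)"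
      unfolding sq[OF f]
      by (subst integral_nonneg_eq_0_iff_AE) (auto simp: L2_rel_def sq_integrable_def)
  qed
qed

end


lemma sq_integrable_diff:
  assumes "sq_integrable M f" "sq_integrable M g"
  shows "sq_integrable M (\<lambda>x. f x - g x)"
  using sq_integrable_add[OF assms(1) sq_integrable_scaleR[OF assms(2), of "-1"]] by simp

lemma sq_integrable_L2_rep: "sq_integrable (L2_measure TYPE('n)) (L2_rep (u :: 'n L2))"
  using Quotient3_rep_reflp[OF Quotient3_L2, of u] by (simp add: L2_rel_def)

lemma L2_of_rep: "L2_of (L2_rep u) = u"
  by (rule Quotient3_abs_rep[OF Quotient3_L2])

lemma L2_of_eq_iff:
  assumes "sq_integrable (L2_measure TYPE('n)) f" "sq_integrable (L2_measure TYPE('n)) g"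
  shows "L2_of f = (L2_of g :: 'n L2) \<longleftrightarrow> (AE x in L2_measure TYPE('n). f x = g x)"
  using Quotient3_rel[OF Quotient3_L2[where 'n='n], of f g] assms by (simp add: L2_rel_def)

lemma inner_L2_of:
  assumes "sq_integrable (L2_measure TYPE('n)) f" "sq_integrable (L2_measure TYPE('n)) g"
  shows "inner (L2_of f) (L2_of g :: 'n L2) = Re (\<integral>x. f x * cnj (g x) \<partial>L2_measure TYPE('n))"
  by (rule inner_L2.abs_eq) (use assms in \<open>simp_all add: L2_rel_def\<close>)

lemma norm_L2_of:
  assumes "sq_integrable (L2_measure TYPE('n)) f"
  shows "norm (L2_of f :: 'n L2) = sqrt (\<integral>x. (cmod (f x))\<^sup>2 \<partial>L2_measure TYPE('n))"
proof -
  have "(\<integral>x. f x * cnj (f x) \<partial>L2_measure TYPE('n)) = (\<integral>x. complex_of_real ((cmod (f x))\<^sup>2) \<partial>L2_measure TYPE('n))"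
    by (intro Bochner_Integration.integral_cong refl) (simp add: complex_norm_square del: of_real_power)
  then show ?thesis
    by (simp add: norm_L2_def inner_L2_of assms del: of_real_power)
qed

lemma L2_of_diff:
  assumes "sq_integrable (L2_measure TYPE('n)) f" "sq_integrable (L2_measure TYPE('n)) g"
  shows "L2_of f - L2_of g = (L2_of (\<lambda>x. f x - g x) :: 'n L2)"
proof -
  have *: "L2_rel TYPE('n) f f" "L2_rel TYPE('n) g g"
    "L2_rel TYPE('n) (\<lambda>x. -1 *\<^sub>R g x) (\<lambda>x. -1 *\<^sub>R g x)"
    using assms sq_integrable_scaleR[OF assms(2), of "-1"] by (simp_all add: L2_rel_def)
  show ?thesis
    unfolding minus_L2_def scaleR_L2.abs_eq[OF *(2)] plus_L2.abs_eq[OF *(1,3)]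
    by simp
qed

lemma finite_measure_L2_measure: "finite_measure (L2_measure i)"
  unfolding L2_measure_def by (rule finite_measure_lebesgue_on) simp

text \<open>Riesz--Fischer: the spaces are complete, i.e. Hilbert spaces.\<close>

instance L2 :: (type) banach
proof
  fix X :: "nat \<Rightarrow> 'a L2" assume "Cauchy X"
  let ?M = "L2_measure TYPE('a)"
  interpret finite_measure ?M by (rule finite_measure_L2_measure)
  define f where "f n = L2_rep (X n)" for n
  have f: "sq_integrable ?M (f n)" for n
    unfolding f_def by (rule sq_integrable_L2_rep)
  have X: "X n = L2_of (f n)" for n
    by (simp add: f_def L2_of_rep)
  have fm [measurable]: "f n \<in> borel_measurable ?M" for n
    using f[of n] by (simp add: sq_integrable_def)
  have "\<exists>K. \<forall>m\<ge>K. \<forall>m'\<ge>K. norm (X m - X m') < (1/2)^n" for n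
    using \<open>Cauchy X\<close> unfolding Cauchy_def dist_norm by simp
  then obtain K where K: "\<And>n m m'. m \<ge> K n \<Longrightarrow> m' \<ge> K n \<Longrightarrow> norm (X m - X m') < (1/2)^n"
    by metis
  define r where "r n = (\<Sum>i\<le>n. K i)" for n
  have rK: "r j \<ge> K n" if "j \<ge> n" for j n
    unfolding r_def using that by (intro member_le_sum) auto
  define h where "h j x = cmod (f (r (Suc j)) x - f (r j) x)" for j x
  have hm [measurable]: "h j \<in> borel_measurable ?M" for j
    unfolding h_def by measurable
  have h_nonneg: "0 \<le> h j x" for j x
    by (simp add: h_def)
  have one: "sq_integrable ?M (\<lambda>_. 1)"
    by (simp add: sq_integrable_def)
  have h: "integrable ?M (h j)" "(\<integral>x. h j x \<partial>?M) \<le> norm (L2_of (\<lambda>_. 1) :: 'a L2) * (1/2)^j" for j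
  proof -
    have sd: "sq_integrable ?M (\<lambda>x. f (r (Suc j)) x - f (r j) x)"
      by (intro sq_integrable_diff f)
    have sh: "sq_integrable ?M (\<lambda>x. complex_of_real (h j x))"
      using sd by (simp add: sq_integrable_def h_def)
    have int: "integrable ?M (\<lambda>x. complex_of_real (h j x))"
      using sq_integrable_mult[OF sh one] by simp
    show "integrable ?M (h j)"
      using integrable_Re[OF int] by simp
    have "(\<integral>x. h j x \<partial>?M) = inner (L2_of (\<lambda>x. complex_of_real (h j x))) (L2_of (\<lambda>_. 1) :: 'a L2)"
      by (simp add: inner_L2_of sh one)
    also have "\<dots> \<le> norm (L2_of (\<lambda>x. complex_of_real (h j x)) :: 'a L2) * norm (L2_of (\<lambda>_. 1) :: 'a L2)"
      by (rule norm_cauchy_schwarz)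
    also have "norm (L2_of (\<lambda>x. complex_of_real (h j x)) :: 'a L2) = norm (X (r (Suc j)) - X (r j))"
      by (simp add: X L2_of_diff f norm_L2_of sh sd) (simp add: h_def)
    also have "\<dots> \<le> (1/2)^j"
      using K[of j "r (Suc j)" "r j"] rK by (simp add: less_imp_le)
    finally show "(\<integral>x. h j x \<partial>?M) \<le> norm (L2_of (\<lambda>_. 1) :: 'a L2) * (1/2)^j"
      by (simp add: mult_right_mono mult.commute)
  qed
  have summ: "AE x in ?M. summable (\<lambda>j. h j x)"
  proof -
    have "(\<integral>\<^sup>+x. (\<Sum>j. ennreal (h j x)) \<partial>?M) = (\<Sum>j. \<integral>\<^sup>+x. ennreal (h j x) \<partial>?M)"
      by (rule nn_integral_suminf) simp
    also have "\<dots> \<le> (\<Sum>j. ennreal (norm (L2_of (\<lambda>_. 1) :: 'a L2) * (1/2)^j))"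
    proof (intro suminf_le)
      show "(\<integral>\<^sup>+x. ennreal (h j x) \<partial>?M) \<le> ennreal (norm (L2_of (\<lambda>_. 1) :: 'a L2) * (1/2)^j)" for j
        using h(2)[of j] by (simp add: nn_integral_eq_integral[OF h(1)] h_nonneg ennreal_leI)
    qed auto
    also have "\<dots> = ennreal (\<Sum>j. norm (L2_of (\<lambda>_. 1) :: 'a L2) * (1/2)^j)"
      by (rule suminf_ennreal2) (auto intro!: summable_mult summable_geometric)
    also have "\<dots> < \<infinity>" by simp
    finally have "AE x in ?M. (\<Sum>j. ennreal (h j x)) \<noteq> \<infinity>"
      by (intro nn_integral_noteq_infinite) (auto simp: less_top)
    then show ?thesis
    proof eventually_elim
      case (elim x)
      then show ?case
        by (intro summable_suminf_not_top) (auto simp: h_def)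
    qed
  qed
  define g where "g x = lim (\<lambda>j. f (r j) x)" for x
  have lim: "AE x in ?M. (\<lambda>j. f (r j) x) \<longlonglongrightarrow> g x"
    using summ
  proof eventually_elim
    case (elim x)
    then have "summable (\<lambda>j. f (r (Suc j)) x - f (r j) x)"
      unfolding h_def by (rule summable_norm_cancel)
    then obtain l where "(\<lambda>n. \<Sum>j<n. f (r (Suc j)) x - f (r j) x) \<longlonglongrightarrow> l"
      by (auto simp: summable_def sums_def)
    then have "(\<lambda>n. f (r n) x - f (r 0) x) \<longlonglongrightarrow> l"
      by (subst (asm) sum_lessThan_telescope)
    then have "(\<lambda>n. (f (r n) x - f (r 0) x) + f (r 0) x) \<longlonglongrightarrow> l + f (r 0) x"
      by (intro tendsto_add tendsto_const)
    then have "convergent (\<lambda>n. f (r n) x)"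
      by (auto simp: convergent_def)
    then show ?case
      by (simp add: g_def convergent_LIMSEQ_iff)
  qed
  have gm [measurable]: "g \<in> borel_measurable ?M"
    unfolding g_def by (rule borel_measurable_lim_metric) simp
  have bound: "(\<integral>\<^sup>+x. ennreal ((cmod (f m x - g x))\<^sup>2) \<partial>?M) \<le> ennreal (((1/2)^n)\<^sup>2)" if m: "m \<ge> K n" for m n
  proof -
    have "(\<integral>\<^sup>+x. ennreal ((cmod (f m x - g x))\<^sup>2) \<partial>?M)
        = (\<integral>\<^sup>+x. liminf (\<lambda>j. ennreal ((cmod (f m x - f (r j) x))\<^sup>2)) \<partial>?M)"
    proof (rule nn_integral_cong_AE)
      show "AE x in ?M. ennreal ((cmod (f m x - g x))\<^sup>2)
          = liminf (\<lambda>j. ennreal ((cmod (f m x - f (r j) x))\<^sup>2))"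
        using lim
      proof eventually_elim
        case (elim x)
        then have "(\<lambda>j. ennreal ((cmod (f m x - f (r j) x))\<^sup>2)) \<longlonglongrightarrow> ennreal ((cmod (f m x - g x))\<^sup>2)"
          by (intro tendsto_intros)
        then show ?case
          by (rule lim_imp_Liminf[symmetric, rotated]) simp
      qed
    qed
    also have "\<dots> \<le> liminf (\<lambda>j. \<integral>\<^sup>+x. ennreal ((cmod (f m x - f (r j) x))\<^sup>2) \<partial>?M)"
      by (rule nn_integral_liminf) measurable
    also have "\<dots> \<le> ennreal (((1/2)^n)\<^sup>2)"
    proof (rule Liminf_le)
      show "\<forall>\<^sub>F j in sequentially. (\<integral>\<^sup>+x. ennreal ((cmod (f m x - f (r j) x))\<^sup>2) \<partial>?M) \<le> ennreal (((1/2)^n)\<^sup>2)"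
        using eventually_ge_at_top[of n]
      proof eventually_elim
        case (elim j)
        have sd: "sq_integrable ?M (\<lambda>x. f m x - f (r j) x)"
          by (intro sq_integrable_diff f)
        have "(\<integral>\<^sup>+x. ennreal ((cmod (f m x - f (r j) x))\<^sup>2) \<partial>?M) = ennreal (\<integral>x. (cmod (f m x - f (r j) x))\<^sup>2 \<partial>?M)"
          using sd by (intro nn_integral_eq_integral) (auto simp: sq_integrable_def)
        also have "(\<integral>x. (cmod (f m x - f (r j) x))\<^sup>2 \<partial>?M) = (norm (X m - X (r j)))\<^sup>2"
          by (simp add: X L2_of_diff f norm_L2_of sd)
        also have "\<dots> \<le> ((1/2)^n)\<^sup>2"
          using K[OF m rK[OF elim]] by (intro power_mono) auto
        finally show ?case by (simp add: ennreal_leI)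
      qed
    qed simp
    finally show ?thesis .
  qed
  have sfg: "sq_integrable ?M (\<lambda>x. f m x - g x)" if "m \<ge> K n" for m n
    unfolding sq_integrable_def
  proof
    show "integrable ?M (\<lambda>x. (cmod (f m x - g x))\<^sup>2)"
      using bound[OF that] by (intro integrableI_nonneg) (auto simp: less_top[symmetric] top_unique)
  qed measurable
  have g: "sq_integrable ?M g"
    using sq_integrable_diff[OF f[of "K 0"] sfg[of 0 "K 0"]] by simp
  have le: "norm (X m - L2_of g) \<le> (1/2)^n" if "m \<ge> K n" for m n
  proof -
    have "ennreal (\<integral>x. (cmod (f m x - g x))\<^sup>2 \<partial>?M) = (\<integral>\<^sup>+x. ennreal ((cmod (f m x - g x))\<^sup>2) \<partial>?M)"
      using sfg[OF that] by (intro nn_integral_eq_integral[symmetric]) (auto simp: sq_integrable_def)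
    then have "ennreal (\<integral>x. (cmod (f m x - g x))\<^sup>2 \<partial>?M) \<le> ennreal (((1/2)^n)\<^sup>2)"
      using bound[OF that] by simp
    then have "(\<integral>x. (cmod (f m x - g x))\<^sup>2 \<partial>?M) \<le> ((1/2)^n)\<^sup>2"
      by (subst (asm) ennreal_le_iff) simp_all
    then have "sqrt (\<integral>x. (cmod (f m x - g x))\<^sup>2 \<partial>?M) \<le> sqrt (((1/2)^n)\<^sup>2)"
      by (rule real_sqrt_le_mono)
    also have "sqrt (((1/2)^n)\<^sup>2) = ((1/2)^n :: real)"
      by (rule real_sqrt_unique) simp_all
    finally show ?thesis
      by (simp add: X L2_of_diff f g norm_L2_of sfg[OF that])
  qed
  have "X \<longlonglongrightarrow> L2_of g"
  proof (rule LIMSEQ_I)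
    fix e :: real assume "e > 0"
    then obtain n where "(1/2)^n < e"
      using real_arch_pow_inv[of e "1/2"] by auto
    then show "\<exists>no. \<forall>m\<ge>no. norm (X m - L2_of g) < e"
      using le[where n=n] by (meson le_less_trans)
  qed
  then show "convergent X" by (auto simp: convergent_def)
qed

text \<open>The representative, extended by zero to the whole line.\<close>

definition L2_fun :: "'n L2 \<Rightarrow> real \<Rightarrow> complex" where
  "L2_fun u x = (if x \<in> {0..real CARD('n)} then L2_rep u x else 0)"


section \<open>The Hahn--Banach theorem for a sublinear functional on a subspace\<close>

definition sublin_on :: "'a::real_vector set \<Rightarrow> ('a \<Rightarrow> real) \<Rightarrow> bool" where
  "sublin_on E p \<longleftrightarrow> (\<forall>x\<in>E. \<forall>y\<in>E. p (x + y) \<le> p x + p y) \<and> (\<forall>x\<in>E. \<forall>c\<ge>0. p (c *\<^sub>R x) = c * p x)"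

lemma sublin_on_zero:
  assumes "sublin_on E p" "subspace E"
  shows "p 0 = 0"
proof -
  have "p (0 *\<^sub>R 0) = 0 * p 0"
    using assms subspace_0[of E] unfolding sublin_on_def by blast
  then show ?thesis by simp
qed

lemma sublin_on_reduce:
  assumes q: "sublin_on E q" and E: "subspace E" and y: "y \<in> E"
  obtains q' where "sublin_on E q'" "\<And>x. x \<in> E \<Longrightarrow> q' x \<le> q x"
    "\<And>x. x \<in> E \<Longrightarrow> q' x \<le> q (x + y) - q y" "\<And>x. x \<notin> E \<Longrightarrow> q' x = 0"
proof -
  define q' where "q' x = (if x \<in> E then INF t\<in>{0..}. q (x + t *\<^sub>R y) - t * q y else 0)" for x
  have add: "q (a + b) \<le> q a + q b" if "a \<in> E" "b \<in> E" for a b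
    using q that by (simp add: sublin_on_def)
  have scale: "q (c *\<^sub>R a) = c * q a" if "a \<in> E" "0 \<le> c" for a c
    using q that by (simp add: sublin_on_def)
  note sub = subspace_add[OF E] subspace_scale[OF E] subspace_neg[OF E]
  have lb: "- q (- x) \<le> q (x + t *\<^sub>R y) - t * q y" if "x \<in> E" "0 \<le> t" for x t
    using add[of "x + t *\<^sub>R y" "- x"] scale[OF y that(2)] that y by (simp add: sub)
  have bdd: "bdd_below ((\<lambda>t. q (x + t *\<^sub>R y) - t * q y) ` {0..})" if "x \<in> E" for x
    using lb[OF that] by (intro bdd_belowI2[of _ "- q (- x)"]) auto
  have up: "q' x \<le> q (x + t *\<^sub>R y) - t * q y" if "x \<in> E" "0 \<le> t" for x t
    unfolding q'_def using that by (auto intro!: cINF_lower bdd)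
  have low: "c \<le> q' x" if "x \<in> E" "\<And>t. 0 \<le> t \<Longrightarrow> c \<le> q (x + t *\<^sub>R y) - t * q y" for x c
    unfolding q'_def using that by (auto intro!: cINF_greatest)
  have le1: "q' x \<le> q x" if "x \<in> E" for x
    using up[OF that, of 0] by simp
  have le2: "q' x \<le> q (x + y) - q y" if "x \<in> E" for x
    using up[OF that, of 1] by simp
  have le: "q' (c *\<^sub>R x) \<le> c * q' x" if "x \<in> E" "0 < c" for x c
  proof -
    have "q' (c *\<^sub>R x) / c \<le> q' x"
    proof (rule low[OF \<open>x \<in> E\<close>])
      fix t :: real assume "0 \<le> t"
      have "q' (c *\<^sub>R x) \<le> q (c *\<^sub>R x + (c * t) *\<^sub>R y) - (c * t) * q y"
        using that \<open>0 \<le> t\<close> by (intro up) (auto simp: sub)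
      also have "c *\<^sub>R x + (c * t) *\<^sub>R y = c *\<^sub>R (x + t *\<^sub>R y)"
        by (simp add: scaleR_add_right)
      also have "q \<dots> = c * q (x + t *\<^sub>R y)"
        using that y by (intro scale) (auto simp: sub)
      finally have "q' (c *\<^sub>R x) \<le> c * (q (x + t *\<^sub>R y) - t * q y)"
        by (simp add: algebra_simps)
      then show "q' (c *\<^sub>R x) / c \<le> q (x + t *\<^sub>R y) - t * q y"
        using that by (simp add: divide_le_eq mult.commute)
    qed
    then show ?thesis using that by (simp add: divide_le_eq mult.commute)
  qed
  have zero: "q' 0 = 0"
  proof (rule antisym)
    have "q 0 = 0" by (rule sublin_on_zero[OF q E])
    then show "q' 0 \<le> 0" using up[of 0 0] subspace_0[OF E] by simp
    show "0 \<le> q' 0"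
      using subspace_0[OF E] scale[OF y] by (intro low) auto
  qed
  have "sublin_on E q'"
    unfolding sublin_on_def
  proof (intro conjI ballI allI impI)
    fix x z assume xz: "x \<in> E" "z \<in> E"
    have "q' (x + z) - q' x \<le> q' z"
    proof (rule low[OF xz(2)])
      fix t :: real assume t: "0 \<le> t"
      have "q' (x + z) - (q (z + t *\<^sub>R y) - t * q y) \<le> q' x"
      proof (rule low[OF xz(1)])
        fix s :: real assume s: "0 \<le> s"
        have "q' (x + z) \<le> q ((x + z) + (s + t) *\<^sub>R y) - (s + t) * q y"
          using xz s t by (intro up) (auto simp: sub)
        also have "(x + z) + (s + t) *\<^sub>R y = (x + s *\<^sub>R y) + (z + t *\<^sub>R y)"
          by (simp add: scaleR_add_left)
        also have "q \<dots> \<le> q (x + s *\<^sub>R y) + q (z + t *\<^sub>R y)"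
          using xz y by (intro add) (auto simp: sub)
        finally show "q' (x + z) - (q (z + t *\<^sub>R y) - t * q y) \<le> q (x + s *\<^sub>R y) - s * q y"
          by (simp add: algebra_simps)
      qed
      then show "q' (x + z) - q' x \<le> q (z + t *\<^sub>R y) - t * q y" by linarith
    qed
    then show "q' (x + z) \<le> q' x + q' z" by linarith
  next
    fix x and c :: real assume x: "x \<in> E" and c: "0 \<le> c"
    show "q' (c *\<^sub>R x) = c * q' x"
    proof (cases "c = 0")
      case True
      then show ?thesis using zero by simp
    next
      case False
      have "q' ((1/c) *\<^sub>R (c *\<^sub>R x)) \<le> (1/c) * q' (c *\<^sub>R x)"
        using x c False by (intro le) (auto simp: sub)
      then have "c * q' x \<le> q' (c *\<^sub>R x)"
        using c False by (simp add: field_simps)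
      then show ?thesis using le[OF x, of c] c False by simp
    qed
  qed
  moreover have "q' x = 0" if "x \<notin> E" for x
    using that by (simp add: q'_def)
  ultimately show ?thesis
    using that le1 le2 by blast
qed

theorem hahn_banach_sublin:
  assumes p: "sublin_on E p" and E: "subspace E" and x0: "x0 \<in> E"
  obtains f where "\<And>x y. x \<in> E \<Longrightarrow> y \<in> E \<Longrightarrow> f (x + y) = f x + f y"
    "\<And>c x. x \<in> E \<Longrightarrow> f (c *\<^sub>R x) = c * f x" "\<And>x. x \<in> E \<Longrightarrow> f x \<le> p x" "f x0 = p x0"
proof -
  obtain r where r: "sublin_on E r" "\<And>x. x \<in> E \<Longrightarrow> r x \<le> p x"
    "\<And>x. x \<in> E \<Longrightarrow> r x \<le> p (x + x0) - p x0" "\<And>x. x \<notin> E \<Longrightarrow> r x = 0"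
    by (rule sublin_on_reduce[OF p E x0]) blast
  define A where "A = {q. sublin_on E q \<and> (\<forall>x\<in>E. q x \<le> r x) \<and> (\<forall>x. x \<notin> E \<longrightarrow> q x = 0)}"
  define P where "P = (\<lambda>q q' :: 'a \<Rightarrow> real. \<forall>x. q' x \<le> q x)"
  note sub = subspace_add[OF E] subspace_scale[OF E] subspace_neg[OF E] subspace_0[OF E]
  have lb: "- r (- x) \<le> q x" if "q \<in> A" "x \<in> E" for q x
  proof -
    have "- x \<in> E" using that by (simp add: sub)
    moreover have "\<forall>a\<in>E. \<forall>b\<in>E. q (a + b) \<le> q a + q b"
      using that by (simp add: A_def sublin_on_def)
    ultimately have "q (x + - x) \<le> q x + q (- x)"
      using that(2) by blast
    moreover have "q 0 = 0" using that sublin_on_zero[OF _ E] by (auto simp: A_def)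
    moreover have "q (- x) \<le> r (- x)" using that by (auto simp: A_def sub)
    ultimately show ?thesis by simp
  qed
  have "r \<in> A"
    using r(1,4) by (simp add: A_def)
  have "\<exists>m\<in>A. \<forall>a\<in>A. P m a \<longrightarrow> a = m"
  proof (rule predicate_Zorn)
    show "partial_order_on A (relation_of P A)"
      by (rule partial_order_on_relation_ofI) (auto simp: P_def fun_eq_iff intro: order_trans antisym)
    fix C assume C: "C \<in> Chains (relation_of P A)"
    then have CA: "C \<subseteq> A" and ch: "\<And>a b. a \<in> C \<Longrightarrow> b \<in> C \<Longrightarrow> P a b \<or> P b a"
      by (auto simp: Chains_def relation_of_def)
    show "\<exists>u\<in>A. \<forall>a\<in>C. P a u"
    proof (cases "C = {}")
      case True
      then show ?thesis using \<open>r \<in> A\<close> by auto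
    next
      case False
      define u where "u x = (INF q\<in>C. q x)" for x
      have bdd: "bdd_below ((\<lambda>q. q x) ` C)" for x
      proof (cases "x \<in> E")
        case True
        then show ?thesis using lb CA by (intro bdd_belowI2[of _ "- r (- x)"]) auto
      next
        case False
        then show ?thesis using CA by (intro bdd_belowI2[of _ 0]) (auto simp: A_def)
      qed
      have up: "u x \<le> q x" if "q \<in> C" for q x
        unfolding u_def by (rule cINF_lower[OF bdd that])
      have low: "c \<le> u x" if "\<And>q. q \<in> C \<Longrightarrow> c \<le> q x" for c x
        unfolding u_def using False that by (intro cINF_greatest)
      have "u (x + y) \<le> u x + u y" if "x \<in> E" "y \<in> E" for x y
      proof -
        have "u (x + y) - u y \<le> u x"
        proof (rule low)
          fix q assume q: "q \<in> C"
          have "u (x + y) - q x \<le> u y"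
          proof (rule low)
            fix q' assume q': "q' \<in> C"
            obtain q'' where q'': "q'' \<in> C" "P q q''" "P q' q''"
              using ch[OF q q'] q q' by (auto simp: P_def)
            have "u (x + y) \<le> q'' (x + y)" by (rule up[OF q''(1)])
            also have "\<dots> \<le> q'' x + q'' y"
              using q''(1) CA that by (auto simp: A_def sublin_on_def)
            also have "\<dots> \<le> q x + q' y"
              using q'' by (auto simp: P_def intro: add_mono)
            finally show "u (x + y) - q x \<le> q' y" by simp
          qed
          then show "u (x + y) - u y \<le> q x" by simp
        qed
        then show ?thesis by simp
      qed
      moreover have "u (c *\<^sub>R x) = c * u x" if "x \<in> E" "0 \<le> c" for x c
      proof -
        have eq: "q (c *\<^sub>R x) = c * q x" if "q \<in> C" for q
          using \<open>x \<in> E\<close> \<open>0 \<le> c\<close> that CA by (auto simp: A_def sublin_on_def)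
        show ?thesis
        proof (cases "c = 0")
          case True
          have "(\<lambda>q. q 0) ` C = (\<lambda>q. 0) ` C"
            using CA by (intro image_cong refl sublin_on_zero[OF _ E]) (auto simp: A_def)
          then have "u 0 = 0" using False by (simp add: u_def)
          then show ?thesis using True by simp
        next
          case c: False
          have "u (c *\<^sub>R x) / c \<le> u x"
          proof (rule low)
            fix q assume q: "q \<in> C"
            show "u (c *\<^sub>R x) / c \<le> q x"
              using up[OF q, of "c *\<^sub>R x"] eq[OF q] c \<open>0 \<le> c\<close> by (simp add: divide_le_eq mult.commute)
          qed
          moreover have "c * u x \<le> u (c *\<^sub>R x)"
          proof (rule low)
            fix q assume q: "q \<in> C"
            show "c * u x \<le> q (c *\<^sub>R x)"
              using up[OF q, of x] eq[OF q] \<open>0 \<le> c\<close> by (simp add: mult_left_mono)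
          qed
          ultimately show ?thesis using c \<open>0 \<le> c\<close> by (simp add: divide_le_eq mult.commute)
        qed
      qed
      moreover have "u x = 0" if "x \<notin> E" for x
      proof -
        have "(\<lambda>q. q x) ` C = (\<lambda>q. 0) ` C"
          using CA that by (intro image_cong refl) (auto simp: A_def)
        then show ?thesis using False by (simp add: u_def)
      qed
      moreover have "u x \<le> r x" if "x \<in> E" for x
      proof -
        obtain q where "q \<in> C" using False by auto
        then show ?thesis using up[of q x] CA that by (force simp: A_def)
      qed
      ultimately have "u \<in> A" by (auto simp: A_def sublin_on_def)
      then show ?thesis using up by (auto simp: P_def)
    qed
  qed
  then obtain f where f: "f \<in> A" and min: "\<And>a. a \<in> A \<Longrightarrow> (\<And>x. a x \<le> f x) \<Longrightarrow> a = f"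
    by (auto simp: P_def)
  have fs: "sublin_on E f" using f by (simp add: A_def)
  have f0: "f 0 = 0" by (rule sublin_on_zero[OF fs E])
  have add: "f (x + y) = f x + f y" if xy: "x \<in> E" "y \<in> E" for x y
  proof -
    obtain f' where f': "sublin_on E f'" "\<And>z. z \<in> E \<Longrightarrow> f' z \<le> f z"
      "\<And>z. z \<in> E \<Longrightarrow> f' z \<le> f (z + y) - f y" "\<And>z. z \<notin> E \<Longrightarrow> f' z = 0"
      by (rule sublin_on_reduce[OF fs E xy(2)]) blast
    have "f' \<in> A"
    proof -
      have "f' z \<le> r z" if "z \<in> E" for z
        using f f'(2)[OF that] that by (force simp: A_def)
      moreover have "f' z = 0" if "z \<notin> E" for z
        using that by (rule f'(4))
      ultimately show ?thesis using f'(1) by (simp add: A_def)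
    qed
    moreover have "f' z \<le> f z" for z
      using f'(2)[of z] f by (cases "z \<in> E") (auto simp: A_def f'(4))
    ultimately have "f' = f" by (rule min)
    then have "f x \<le> f (x + y) - f y" using f'(3)[OF xy(1)] by simp
    moreover have "f (x + y) \<le> f x + f y" using fs xy by (simp add: sublin_on_def)
    ultimately show ?thesis by simp
  qed
  have scale: "f (c *\<^sub>R x) = c * f x" if "x \<in> E" for c x
  proof (cases "0 \<le> c")
    case True
    then show ?thesis using fs that by (simp add: sublin_on_def)
  next
    case False
    have "f (c *\<^sub>R x) + f ((- c) *\<^sub>R x) = f (c *\<^sub>R x + (- c) *\<^sub>R x)"
      using that by (intro add[symmetric]) (auto simp: sub)
    also have "\<dots> = 0" using f0 by simp
    also have "f ((- c) *\<^sub>R x) = - c * f x"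
      using fs that False by (simp add: sublin_on_def del: scaleR_minus_left)
    finally show ?thesis by simp
  qed
  have le: "f x \<le> p x" if "x \<in> E" for x
    using f that r(2)[OF that] by (force simp: A_def)
  have "f (- x0) \<le> r (- x0)" using f x0 by (simp add: A_def sub)
  also have "\<dots> \<le> - p x0"
    using r(3)[of "- x0"] x0 sublin_on_zero[OF p E] by (simp add: sub)
  finally have "p x0 \<le> f x0"
    using scale[OF x0, of "-1"] by simp
  with le[OF x0] have "f x0 = p x0" by simp
  with add scale le show ?thesis by (rule that)
qed

lemma norming_functional:
  fixes y :: "'a::real_normed_vector"
  obtains f :: "'a \<Rightarrow>\<^sub>L real" where "norm f \<le> 1" "blinfun_apply f y = norm y"
proof -
  have "sublin_on UNIV (norm :: 'a \<Rightarrow> real)"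
    by (simp add: sublin_on_def norm_triangle_ineq)
  then obtain f where f: "\<And>x y. f (x + y) = f x + f y" "\<And>c x. f (c *\<^sub>R x) = c * f x"
      "\<And>x. f x \<le> norm (x :: 'a)" "f y = norm y"
    using hahn_banach_sublin[of UNIV norm y] by (metis UNIV_I subspace_UNIV)
  have b: "\<bar>f x\<bar> \<le> norm x" for x
    using f(3)[of x] f(3)[of "- x"] f(2)[of "-1" x] by simp
  have bl: "bounded_linear f"
    by (rule bounded_linear_intro[where K=1]) (use f b in auto)
  show ?thesis
  proof (rule that[of "Blinfun f"])
    show "norm (Blinfun f) \<le> 1"
      by (rule norm_blinfun_bound) (use b in \<open>auto simp: bounded_linear_Blinfun_apply[OF bl]\<close>)
    show "blinfun_apply (Blinfun f) y = norm y"
      by (simp add: bounded_linear_Blinfun_apply[OF bl] f)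
  qed
qed


section \<open>The projective tensor product and its symmetric part\<close>

lemma subspace_closure_span: "subspace (closure (span (S :: 'a::real_normed_vector set)))"
  unfolding subspace_def
proof (intro conjI ballI allI)
  show "0 \<in> closure (span S)"
    using closure_subset[of "span S"] span_zero by blast
  fix x y assume "x \<in> closure (span S)" "y \<in> closure (span S)"
  then obtain f g where f: "\<And>n::nat. f n \<in> span S" "f \<longlonglongrightarrow> x" and g: "\<And>n::nat. g n \<in> span S" "g \<longlonglongrightarrow> y"
    by (auto simp: closure_sequential)
  show "x + y \<in> closure (span S)"
    unfolding closure_sequential
    by (rule exI[of _ "\<lambda>n. f n + g n"]) (use f g in \<open>auto intro: span_add tendsto_add\<close>)
next
  fix c x assume "x \<in> closure (span S)"
  then obtain f where f: "\<And>n::nat. f n \<in> span S" "f \<longlonglongrightarrow> x"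
    by (auto simp: closure_sequential)
  show "c *\<^sub>R x \<in> closure (span S)"
    unfolding closure_sequential
    by (rule exI[of _ "\<lambda>n. c *\<^sub>R f n"]) (use f in \<open>auto intro: span_scale tendsto_scaleR\<close>)
qed

text \<open>
  An elementary tensor \<open>x \<otimes> y\<close> is represented by the evaluation \<open>B \<mapsto> B(x,y)\<close> of bounded bilinear
  forms. The projective tensor product is the closure of the span of these evaluations in the
  dual of the space of bounded bilinear forms. That this is the completion of the algebraic tensor
  product under the projective norm is the content of \<open>norm_ptensor_eq_projective_norm\<close>,
  \<open>ptensor_dense\<close> and the universal property \<open>ptensor_universal\<close> below.
\<close>

definition tensor_eval :: "'a::real_normed_vector \<Rightarrow> 'a \<Rightarrow> ('a \<Rightarrow>\<^sub>L 'a \<Rightarrow>\<^sub>L real) \<Rightarrow>\<^sub>L real" where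
  "tensor_eval x y = Blinfun (\<lambda>B. blinfun_apply (blinfun_apply B x) y)"

lemma tensor_eval_apply:
  fixes x y :: "'a::real_normed_vector"
  shows "blinfun_apply (tensor_eval x y) B = blinfun_apply (blinfun_apply B x) y"
proof -
  have "bounded_linear (\<lambda>B :: 'a \<Rightarrow>\<^sub>L 'a \<Rightarrow>\<^sub>L real. blinfun_apply (blinfun_apply B x) y)"
    by (intro bounded_linear_intros)
  then show ?thesis
    by (simp only: tensor_eval_def bounded_linear_Blinfun_apply)
qed

typedef (overloaded) 'a ptensor =
  "closure (span (range (\<lambda>(x, y). tensor_eval x (y :: 'a::real_normed_vector))))"
  using subspace_0[OF subspace_closure_span] by blast

setup_lifting type_definition_ptensor

instantiation ptensor :: (real_normed_vector) real_normed_vector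
begin

lift_definition zero_ptensor :: "'a ptensor" is 0
  by (rule subspace_0[OF subspace_closure_span])
lift_definition plus_ptensor :: "'a ptensor \<Rightarrow> 'a ptensor \<Rightarrow> 'a ptensor" is "(+)"
  by (rule subspace_add[OF subspace_closure_span])
lift_definition minus_ptensor :: "'a ptensor \<Rightarrow> 'a ptensor \<Rightarrow> 'a ptensor" is "(-)"
  by (rule subspace_diff[OF subspace_closure_span])
lift_definition uminus_ptensor :: "'a ptensor \<Rightarrow> 'a ptensor" is uminus
  by (rule subspace_neg[OF subspace_closure_span])
lift_definition scaleR_ptensor :: "real \<Rightarrow> 'a ptensor \<Rightarrow> 'a ptensor" is "(*\<^sub>R)"
  by (rule subspace_scale[OF subspace_closure_span])
lift_definition norm_ptensor :: "'a ptensor \<Rightarrow> real" is norm .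
definition dist_ptensor :: "'a ptensor \<Rightarrow> 'a ptensor \<Rightarrow> real" where
  "dist_ptensor z w = norm (z - w)"
definition sgn_ptensor :: "'a ptensor \<Rightarrow> 'a ptensor" where
  "sgn_ptensor z = scaleR (inverse (norm z)) z"
definition uniformity_ptensor :: "('a ptensor \<times> 'a ptensor) filter" where
  "uniformity_ptensor = (INF e\<in>{0 <..}. principal {(z, w :: 'a ptensor). dist z w < e})"
definition open_ptensor :: "'a ptensor set \<Rightarrow> bool" where
  "open_ptensor S = (\<forall>z\<in>S. \<forall>\<^sub>F (z', w) in uniformity. z' = z \<longrightarrow> w \<in> S)"

instance
proof
  fix a b :: real and u v w :: "'a ptensor" and U :: "'a ptensor set"
  show "u + v + w = u + (v + w)" "u + v = v + u" "0 + u = u" "- u + u = 0" "u - v = u + - v"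
    by (transfer; simp)+
  show "a *\<^sub>R (u + v) = a *\<^sub>R u + a *\<^sub>R v" "(a + b) *\<^sub>R u = a *\<^sub>R u + b *\<^sub>R u"
    "a *\<^sub>R b *\<^sub>R u = (a * b) *\<^sub>R u" "1 *\<^sub>R u = u"
    by (transfer; simp add: scaleR_add_left scaleR_add_right)+
  show "norm u = 0 \<longleftrightarrow> u = 0" "norm (u + v) \<le> norm u + norm v" "norm (a *\<^sub>R u) = \<bar>a\<bar> * norm u"
    by (transfer; simp add: norm_triangle_ineq)+
  show "dist u v = norm (u - v)" by (rule dist_ptensor_def)
  show "sgn u = scaleR (inverse (norm u)) u" by (rule sgn_ptensor_def)
  show "(uniformity :: ('a ptensor \<times> 'a ptensor) filter) = (INF e\<in>{0 <..}. principal {(u, v). dist u v < e})"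
    by (rule uniformity_ptensor_def)
  show "open U = (\<forall>u\<in>U. \<forall>\<^sub>F (u', v) in uniformity. u' = u \<longrightarrow> v \<in> U)" by (rule open_ptensor_def)
qed

end

lemma bounded_linear_Rep_ptensor: "bounded_linear Rep_ptensor"
  by (rule bounded_linear_intro[where K=1])
    (simp_all add: plus_ptensor.rep_eq scaleR_ptensor.rep_eq norm_ptensor.rep_eq)

instance ptensor :: (real_normed_vector) banach
proof
  fix X :: "nat \<Rightarrow> 'a ptensor" assume X: "Cauchy X"
  have d: "dist (Rep_ptensor x) (Rep_ptensor y) = dist x y" for x y :: "'a ptensor"
    by (simp add: dist_norm norm_ptensor.rep_eq minus_ptensor.rep_eq)
  have "Cauchy (\<lambda>n. Rep_ptensor (X n))"
    using X by (simp add: Cauchy_def d)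
  then obtain l where l: "(\<lambda>n. Rep_ptensor (X n)) \<longlonglongrightarrow> l"
    by (auto simp: Cauchy_convergent_iff convergent_def)
  then obtain z :: "'a ptensor" where z: "l = Rep_ptensor z"
    by (metis (no_types, lifting) Rep_ptensor Rep_ptensor_cases closed_closure closed_sequentially)
  have "X \<longlonglongrightarrow> z"
    using l unfolding z tendsto_iff d .
  then show "convergent X" by (auto simp: convergent_def)
qed

lift_definition tensor :: "'a::real_normed_vector \<Rightarrow> 'a \<Rightarrow> 'a ptensor" (infixl \<open>\<otimes>\<close> 75) is tensor_eval
  using closure_subset span_superset by fastforce

lemma norm_tensor_le: "norm (x \<otimes> y) \<le> norm x * norm y"
proof transfer
  fix a b :: 'a
  show "norm (tensor_eval a b) \<le> norm a * norm b"
  proof (rule norm_blinfun_bound)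
    fix B :: "'a \<Rightarrow>\<^sub>L 'a \<Rightarrow>\<^sub>L real"
    have "norm (blinfun_apply (blinfun_apply B a) b) \<le> norm (blinfun_apply B a) * norm b"
      by (rule norm_blinfun)
    also have "\<dots> \<le> norm B * norm a * norm b"
      by (intro mult_right_mono norm_blinfun) simp
    finally show "norm (blinfun_apply (tensor_eval a b) B) \<le> norm a * norm b * norm B"
      by (simp add: tensor_eval_apply mult_ac)
  qed simp
qed

lemma bounded_bilinear_tensor: "bounded_bilinear (\<otimes>)"
proof
  fix a a' b b' :: 'a and r :: real
  show "(a + a') \<otimes> b = a \<otimes> b + a' \<otimes> b" "a \<otimes> (b + b') = a \<otimes> b + a \<otimes> b'"
    "(r *\<^sub>R a) \<otimes> b = r *\<^sub>R (a \<otimes> b)" "a \<otimes> (r *\<^sub>R b) = r *\<^sub>R (a \<otimes> b)"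
    by (transfer; rule blinfun_eqI; simp add: tensor_eval_apply blinfun.bilinear_simps)+
next
  show "\<exists>K. \<forall>a b :: 'a. norm (a \<otimes> b) \<le> norm a * norm b * K"
    by (intro exI[of _ 1]) (simp add: norm_tensor_le)
qed


lemma span_ptensor_list:
  assumes "z \<in> span (range (\<lambda>(x, y). x \<otimes> y))"
  shows "\<exists>xs. (\<Sum>(x, y)\<leftarrow>xs. x \<otimes> y) = z"
  using assms
proof (induction rule: span_induct_alt)
  case base
  show ?case by (rule exI[of _ "[]"]) simp
next
  case (step c w z)
  then obtain x y xs where "w = x \<otimes> y" "z = (\<Sum>(x, y)\<leftarrow>xs. x \<otimes> y)" by auto
  then show ?case
    by (intro exI[of _ "(c *\<^sub>R x, y) # xs"]) (simp add: bounded_bilinear.scaleR_left[OF bounded_bilinear_tensor])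
qed

lemma ptensor_list_in_span: "(\<Sum>(x, y)\<leftarrow>xs. x \<otimes> y) \<in> span (range (\<lambda>(x, y). x \<otimes> y))"
proof (induction xs)
  case (Cons a xs)
  have "(case a of (x, y) \<Rightarrow> x \<otimes> y) \<in> span (range (\<lambda>(x, y). x \<otimes> y))"
    by (rule span_base) (rule rangeI)
  with Cons show ?case by (simp add: span_add)
qed (simp add: span_zero)

lemma ptensor_dense: "closure (span (range (\<lambda>(x, y). x \<otimes> (y :: 'a::real_normed_vector)))) = UNIV"
proof -
  have "z \<in> closure (span (range (\<lambda>(x, y). x \<otimes> y)))" for z :: "'a ptensor"
  proof -
    have "range (\<lambda>(x, y). tensor_eval x y) = Rep_ptensor ` range (\<lambda>(x, y). x \<otimes> (y :: 'a))"
      by (simp add: image_image case_prod_unfold tensor.rep_eq)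
    then have eq: "span (range (\<lambda>(x, y). tensor_eval x y)) = Rep_ptensor ` span (range (\<lambda>(x, y). x \<otimes> (y :: 'a)))"
      using linear_span_image[OF bounded_linear.linear[OF bounded_linear_Rep_ptensor]] by metis
    obtain f where f: "\<And>n::nat. f n \<in> span (range (\<lambda>(x, y). tensor_eval x y))" "f \<longlonglongrightarrow> Rep_ptensor z"
      using Rep_ptensor[of z] by (auto simp: closure_sequential)
    then have "\<forall>n. \<exists>w. w \<in> span (range (\<lambda>(x, y). x \<otimes> (y :: 'a))) \<and> f n = Rep_ptensor w"
      unfolding eq by blast
    then obtain g where g: "\<And>n. g n \<in> span (range (\<lambda>(x, y). x \<otimes> (y :: 'a)))" "\<And>n. f n = Rep_ptensor (g n)"
      by metis
    have d: "dist (Rep_ptensor x) (Rep_ptensor y) = dist x y" for x y :: "'a ptensor"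
      by (simp add: dist_norm norm_ptensor.rep_eq minus_ptensor.rep_eq)
    have "g \<longlonglongrightarrow> z"
      using f(2) unfolding tendsto_iff g(2) d .
    then show ?thesis
      using g(1) by (auto simp: closure_sequential)
  qed
  then show ?thesis by blast
qed

lemma bilinear_form_blinfun:
  fixes g :: "'a::real_normed_vector \<Rightarrow> 'a \<Rightarrow> real"
  assumes g: "bounded_bilinear g" and K: "\<And>x y. \<bar>g x y\<bar> \<le> K * norm x * norm y" "0 \<le> K"
  obtains B :: "'a \<Rightarrow>\<^sub>L 'a \<Rightarrow>\<^sub>L real" where
    "\<And>x y. blinfun_apply (blinfun_apply B x) y = g x y" "norm B \<le> K"
proof -
  interpret bounded_bilinear g by (rule g)
  have app: "blinfun_apply (Blinfun (g x)) y = g x y" for x y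
    by (simp add: bounded_linear_Blinfun_apply bounded_linear_right)
  have le: "norm (Blinfun (g x)) \<le> K * norm x" for x
    by (rule norm_blinfun_bound) (use K in \<open>auto simp: app\<close>)
  have bl: "bounded_linear (\<lambda>x. Blinfun (g x))"
  proof (rule bounded_linear_intro[where K=K])
    show "Blinfun (g (x + y)) = Blinfun (g x) + Blinfun (g y)" for x y
      by (rule blinfun_eqI) (simp add: app add_left blinfun.add_left)
    show "Blinfun (g (r *\<^sub>R x)) = r *\<^sub>R Blinfun (g x)" for r x
      by (rule blinfun_eqI) (simp add: app scaleR_left blinfun.scaleR_left)
    show "norm (Blinfun (g x)) \<le> norm x * K" for x
      using le[of x] by (simp add: mult.commute)
  qed
  show ?thesis
  proof (rule that[of "Blinfun (\<lambda>x. Blinfun (g x))"])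
    show "blinfun_apply (blinfun_apply (Blinfun (\<lambda>x. Blinfun (g x))) x) y = g x y" for x y
      by (simp add: bounded_linear_Blinfun_apply[OF bl] app)
    show "norm (Blinfun (\<lambda>x. Blinfun (g x))) \<le> K"
      by (rule norm_blinfun_bound) (use K le in \<open>auto simp: bounded_linear_Blinfun_apply[OF bl]\<close>)
  qed
qed

lemma Rep_ptensor_list:
  "blinfun_apply (Rep_ptensor (\<Sum>(x, y)\<leftarrow>xs. x \<otimes> y)) B = (\<Sum>(x, y)\<leftarrow>xs. blinfun_apply (blinfun_apply B x) y)"
  by (induction xs)
    (auto simp: zero_ptensor.rep_eq plus_ptensor.rep_eq tensor.rep_eq tensor_eval_apply blinfun.add_left)

theorem norm_ptensor_eq_projective_norm:
  fixes z :: "'a::real_normed_vector ptensor"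
  assumes z: "z \<in> span (range (\<lambda>(x, y). x \<otimes> y))"
  shows "norm z = (INF xs \<in> {xs. (\<Sum>(x, y)\<leftarrow>xs. x \<otimes> y) = z}. \<Sum>(x, y)\<leftarrow>xs. norm x * norm y)"
proof -
  let ?D = "span (range (\<lambda>(x, y). x \<otimes> (y :: 'a)))"
  define cost where "cost xs = (\<Sum>(x, y)\<leftarrow>xs. norm x * norm y)" for xs :: "('a \<times> 'a) list"
  define tot where "tot xs = (\<Sum>(x, y)\<leftarrow>xs. x \<otimes> y)" for xs :: "('a \<times> 'a) list"
  define p where "p z = (INF xs \<in> {xs. tot xs = z}. cost xs)" for z
  have cost_nn: "0 \<le> cost xs" for xs
    unfolding cost_def by (intro sum_list_nonneg) auto
  have bdd: "bdd_below (cost ` S)" for S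
    using cost_nn by (intro bdd_belowI2[of _ 0]) auto
  have up: "p (tot xs) \<le> cost xs" for xs
    unfolding p_def by (rule cINF_lower[OF bdd]) simp
  have low: "c \<le> p z" if "z \<in> ?D" "\<And>xs. tot xs = z \<Longrightarrow> c \<le> cost xs" for z c
    unfolding p_def using span_ptensor_list[OF that(1)] that(2)
    by (intro cINF_greatest) (auto simp: tot_def)
  have tot_append: "tot (xs @ ys) = tot xs + tot ys" and cost_append: "cost (xs @ ys) = cost xs + cost ys" for xs ys
    by (simp_all add: tot_def cost_def)
  have tot_scale: "tot (map (\<lambda>(x, y). (c *\<^sub>R x, y)) xs) = c *\<^sub>R tot xs" for c xs
    unfolding tot_def
    by (induction xs) (simp_all add: split_def scaleR_add_right
        bounded_bilinear.scaleR_left[OF bounded_bilinear_tensor])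
  have cost_scale: "cost (map (\<lambda>(x, y). (c *\<^sub>R x, y)) xs) = \<bar>c\<bar> * cost xs" for c xs
    unfolding cost_def
    by (induction xs) (simp_all add: split_def distrib_left)
  have norm_le: "norm (tot xs) \<le> cost xs" for xs
  proof (induction xs)
    case (Cons a xs)
    obtain x y where a: "a = (x, y)" by (cases a)
    have "norm (tot (a # xs)) \<le> norm (x \<otimes> y) + norm (tot xs)"
      by (simp add: tot_def a norm_triangle_ineq)
    then show ?case using Cons norm_tensor_le[of x y] by (simp add: cost_def a)
  qed (simp add: tot_def cost_def)
  have sub_scale: "p (c *\<^sub>R w) \<le> \<bar>c\<bar> * p w" if "w \<in> ?D" "c \<noteq> 0" for c w
  proof -
    have "p (c *\<^sub>R w) / \<bar>c\<bar> \<le> p w"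
    proof (rule low[OF that(1)])
      fix xs assume "tot xs = w"
      then show "p (c *\<^sub>R w) / \<bar>c\<bar> \<le> cost xs"
        using up[of "map (\<lambda>(x, y). (c *\<^sub>R x, y)) xs"] that(2)
        by (simp add: tot_scale cost_scale divide_le_eq mult.commute)
    qed
    then show ?thesis using that(2) by (simp add: divide_le_eq mult.commute)
  qed
  have p0: "p 0 = 0"
  proof (rule antisym)
    show "p 0 \<le> 0" using up[of "[]"] by (simp add: tot_def cost_def)
    show "0 \<le> p 0" by (rule low) (simp_all add: span_zero cost_nn)
  qed
  have "sublin_on ?D p"
    unfolding sublin_on_def
  proof (intro conjI ballI allI impI)
    fix v w assume v: "v \<in> ?D" and w: "w \<in> ?D"
    have "p (v + w) - p w \<le> p v"
    proof (rule low[OF v])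
      fix xs assume xs: "tot xs = v"
      have "p (v + w) - cost xs \<le> p w"
      proof (rule low[OF w])
        fix ys assume "tot ys = w"
        then show "p (v + w) - cost xs \<le> cost ys"
          using up[of "xs @ ys"] xs by (simp add: tot_append cost_append)
      qed
      then show "p (v + w) - p w \<le> cost xs" by linarith
    qed
    then show "p (v + w) \<le> p v + p w" by linarith
  next
    fix w and c :: real assume w: "w \<in> ?D" and c: "0 \<le> c"
    show "p (c *\<^sub>R w) = c * p w"
    proof (cases "c = 0")
      case True
      then show ?thesis by (simp add: p0)
    next
      case False
      have "p ((1/c) *\<^sub>R (c *\<^sub>R w)) \<le> \<bar>1/c\<bar> * p (c *\<^sub>R w)"
        using w False by (intro sub_scale span_scale) auto
      then have "c * p w \<le> p (c *\<^sub>R w)" using c False by (simp add: field_simps)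
      with sub_scale[OF w False] c show ?thesis by simp
    qed
  qed
  then obtain f where f: "\<And>v w. v \<in> ?D \<Longrightarrow> w \<in> ?D \<Longrightarrow> f (v + w) = f v + f w"
      "\<And>c v. v \<in> ?D \<Longrightarrow> f (c *\<^sub>R v) = c * f v" "\<And>v. v \<in> ?D \<Longrightarrow> f v \<le> p v" "f z = p z"
    by (rule hahn_banach_sublin[OF _ subspace_span z]) blast
  have mem: "x \<otimes> y \<in> ?D" for x y :: 'a
    by (rule span_base) auto
  have fb: "\<bar>f (x \<otimes> y)\<bar> \<le> 1 * norm x * norm y" for x y
  proof -
    have "f (x \<otimes> y) \<le> norm x * norm y" for x y
      using f(3)[OF mem, of x y] up[of "[(x, y)]"] by (simp add: tot_def cost_def)
    from this[of x y] this[of "- x" y] show ?thesis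
      using f(2)[OF mem, of "-1" x y] by (simp add: bounded_bilinear.minus_left[OF bounded_bilinear_tensor])
  qed
  have "bounded_bilinear (\<lambda>x y. f (x \<otimes> y))"
  proof
    interpret t: bounded_bilinear "(\<otimes>) :: 'a \<Rightarrow> _" by (rule bounded_bilinear_tensor)
    fix a a' b b' :: 'a and r :: real
    show "f ((a + a') \<otimes> b) = f (a \<otimes> b) + f (a' \<otimes> b)" "f (a \<otimes> (b + b')) = f (a \<otimes> b) + f (a \<otimes> b')"
      "f ((r *\<^sub>R a) \<otimes> b) = r *\<^sub>R f (a \<otimes> b)" "f (a \<otimes> (r *\<^sub>R b)) = r *\<^sub>R f (a \<otimes> b)"
      by (simp_all add: t.add_left t.add_right t.scaleR_left t.scaleR_right f mem)
    show "\<exists>K. \<forall>a b. norm (f (a \<otimes> b)) \<le> norm a * norm b * K"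
      using fb by (intro exI[of _ 1]) auto
  qed
  then obtain B :: "'a \<Rightarrow>\<^sub>L 'a \<Rightarrow>\<^sub>L real" where
    B: "\<And>x y. blinfun_apply (blinfun_apply B x) y = f (x \<otimes> y)" "norm B \<le> 1"
    by (rule bilinear_form_blinfun[OF _ fb]) auto
  have f0: "f 0 = 0" using f(2)[OF span_zero, of 0] by simp
  have ftot: "f (tot xs) = (\<Sum>(x, y)\<leftarrow>xs. f (x \<otimes> y))" for xs
  proof (induction xs)
    case (Cons a xs)
    have "tot xs \<in> ?D" unfolding tot_def by (rule ptensor_list_in_span)
    with Cons show ?case by (cases a) (simp add: tot_def f mem)
  qed (simp add: tot_def f0)
  obtain xs where xs: "tot xs = z"
    using span_ptensor_list[OF z] by (auto simp: tot_def)
  have "p z = blinfun_apply (Rep_ptensor z) B"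
    using ftot[of xs] f(4) unfolding xs[symmetric] by (simp add: tot_def Rep_ptensor_list B)
  also have "\<dots> \<le> norm (Rep_ptensor z) * norm B"
    using norm_blinfun[of "Rep_ptensor z" B] by simp
  also have "\<dots> \<le> norm z * 1"
    unfolding norm_ptensor.rep_eq by (intro mult_left_mono B) simp
  finally have "p z \<le> norm z" by simp
  moreover have "norm z \<le> p z"
    using norm_le by (intro low[OF z]) auto
  ultimately show ?thesis by (simp add: p_def tot_def cost_def)
qed

theorem ptensor_universal:
  fixes \<beta> :: "'a::real_normed_vector \<Rightarrow> 'a \<Rightarrow> 'b::banach"
  assumes \<beta>: "bounded_bilinear \<beta>" and K: "\<And>x y. norm (\<beta> x y) \<le> K * norm x * norm y" "0 \<le> K"
  obtains T :: "'a ptensor \<Rightarrow>\<^sub>L 'b" where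
    "\<And>x y. blinfun_apply T (x \<otimes> y) = \<beta> x y" "norm T \<le> K"
    "\<And>T'. (\<And>x y. blinfun_apply T' (x \<otimes> y) = \<beta> x y) \<Longrightarrow> T' = T"
proof -
  interpret \<beta>: bounded_bilinear \<beta> by (rule \<beta>)
  have "\<exists>B :: 'a \<Rightarrow>\<^sub>L 'a \<Rightarrow>\<^sub>L real. (\<forall>x y. blinfun_apply (blinfun_apply B x) y = blinfun_apply f (\<beta> x y)) \<and> norm B \<le> norm f * K"
    for f :: "'b \<Rightarrow>\<^sub>L real"
  proof -
    have bb: "bounded_bilinear (\<lambda>x y. blinfun_apply f (\<beta> x y))"
    proof
      show "\<exists>K. \<forall>x y. norm (blinfun_apply f (\<beta> x y)) \<le> norm x * norm y * K"
      proof (intro exI allI)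
        fix x y
        have "norm (blinfun_apply f (\<beta> x y)) \<le> norm f * norm (\<beta> x y)"
          by (rule norm_blinfun)
        also have "\<dots> \<le> norm f * (K * norm x * norm y)"
          by (intro mult_left_mono K) simp
        finally show "norm (blinfun_apply f (\<beta> x y)) \<le> norm x * norm y * (norm f * K)"
          by (simp add: mult_ac)
      qed
    qed (simp_all add: \<beta>.add_left \<beta>.add_right \<beta>.scaleR_left \<beta>.scaleR_right blinfun.bilinear_simps)
    have "\<bar>blinfun_apply f (\<beta> x y)\<bar> \<le> norm f * K * norm x * norm y" for x y
    proof -
      have "\<bar>blinfun_apply f (\<beta> x y)\<bar> \<le> norm f * norm (\<beta> x y)"
        using norm_blinfun[of f "\<beta> x y"] by simp
      also have "\<dots> \<le> norm f * (K * norm x * norm y)"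
        by (intro mult_left_mono K) simp
      finally show ?thesis by (simp add: mult_ac)
    qed
    from bilinear_form_blinfun[OF bb this] K show ?thesis by (metis mult_nonneg_nonneg norm_ge_zero)
  qed
  then obtain B :: "('b \<Rightarrow>\<^sub>L real) \<Rightarrow> ('a \<Rightarrow>\<^sub>L 'a \<Rightarrow>\<^sub>L real)" where
    B: "\<And>f x y. blinfun_apply (blinfun_apply (B f) x) y = blinfun_apply f (\<beta> x y)"
       "\<And>f. norm (B f) \<le> norm f * K"
    by metis
  define G where "G z c \<longleftrightarrow> (\<forall>f. blinfun_apply f c = blinfun_apply (Rep_ptensor z) (B f))" for z c
  have bound: "norm c \<le> K * norm z" if "G z c" for z c
  proof -
    obtain f :: "'b \<Rightarrow>\<^sub>L real" where f: "norm f \<le> 1" "blinfun_apply f c = norm c"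
      by (rule norming_functional)
    have "norm c = blinfun_apply (Rep_ptensor z) (B f)" using that f by (simp add: G_def)
    also have "\<dots> \<le> norm (Rep_ptensor z) * norm (B f)"
      using norm_blinfun[of "Rep_ptensor z" "B f"] by simp
    also have "\<dots> \<le> norm z * (1 * K)"
      unfolding norm_ptensor.rep_eq
      by (intro mult_left_mono order_trans[OF B(2)] mult_right_mono f K) auto
    finally show ?thesis by (simp add: mult.commute)
  qed
  have G_add: "G (z + w) (c + d)" if "G z c" "G w d" for z w c d
    using that by (simp add: G_def plus_ptensor.rep_eq blinfun.add_left blinfun.add_right)
  have G_scale: "G (r *\<^sub>R z) (r *\<^sub>R c)" if "G z c" for r z c
    using that by (simp add: G_def scaleR_ptensor.rep_eq blinfun.scaleR_left blinfun.scaleR_right)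
  have G_diff: "G (z - w) (c - d)" if "G z c" "G w d" for z w c d
    using that by (simp add: G_def minus_ptensor.rep_eq blinfun.diff_left blinfun.diff_right)
  have G_tensor: "G (x \<otimes> y) (\<beta> x y)" for x y
    by (simp add: G_def tensor.rep_eq tensor_eval_apply B)
  have G_unique: "c = d" if "G z c" "G z d" for z c d
    using bound[OF G_diff[OF that]] by simp
  have G_span: "\<exists>c. G z c" if "z \<in> span (range (\<lambda>(x, y). x \<otimes> y))" for z
    using that
  proof (induction rule: span_induct_alt)
    case base
    show ?case using G_scale[OF G_tensor, of 0] by auto
  next
    case (step c w z)
    then show ?case using G_add G_scale G_tensor by (metis (mono_tags, lifting) imageE case_prod_conv surj_pair)
  qed
  have G_ex: "\<exists>c. G z c" for z
  proof -
    have "z \<in> closure (span (range (\<lambda>(x, y). x \<otimes> y)))" by (simp add: ptensor_dense)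
    then obtain g where g: "\<And>n::nat. g n \<in> span (range (\<lambda>(x, y). x \<otimes> y))" "g \<longlonglongrightarrow> z"
      by (auto simp: closure_sequential)
    obtain c where c: "\<And>n. G (g n) (c n)" using G_span[OF g(1)] by metis
    have "Cauchy c"
    proof (rule CauchyI)
      fix e :: real assume "e > 0"
      then have "e / (K + 1) > 0" using K by simp
      then obtain M where M: "\<And>m n. m \<ge> M \<Longrightarrow> n \<ge> M \<Longrightarrow> norm (g m - g n) < e / (K + 1)"
        using LIMSEQ_imp_Cauchy[OF g(2)] by (meson Cauchy_iff)
      show "\<exists>M. \<forall>m\<ge>M. \<forall>n\<ge>M. norm (c m - c n) < e"
      proof (intro exI[of _ M] allI impI)
        fix m n assume "M \<le> m" "M \<le> n"
        have "norm (c m - c n) \<le> K * norm (g m - g n)"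
          by (rule bound[OF G_diff[OF c c]])
        also have "\<dots> \<le> (K + 1) * norm (g m - g n)"
          by (intro mult_right_mono) auto
        also have "\<dots> < e"
          using M[OF \<open>M \<le> m\<close> \<open>M \<le> n\<close>] K by (simp add: less_divide_eq mult.commute add_nonneg_pos)
        finally show "norm (c m - c n) < e" .
      qed
    qed
    then obtain l where l: "c \<longlonglongrightarrow> l" by (auto simp: Cauchy_convergent_iff convergent_def)
    have "G z l"
      unfolding G_def
    proof
      fix f :: "'b \<Rightarrow>\<^sub>L real"
      have "(\<lambda>n. blinfun_apply f (c n)) \<longlonglongrightarrow> blinfun_apply f l"
        by (intro tendsto_intros l)
      moreover have "(\<lambda>n. blinfun_apply (Rep_ptensor (g n)) (B f)) \<longlonglongrightarrow> blinfun_apply (Rep_ptensor z) (B f)"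
        by (intro tendsto_intros bounded_linear.tendsto[OF bounded_linear_Rep_ptensor] g)
      ultimately show "blinfun_apply f l = blinfun_apply (Rep_ptensor z) (B f)"
        using c LIMSEQ_unique by (simp add: G_def)
    qed
    then show ?thesis by blast
  qed
  then obtain T where T: "\<And>z. G z (T z)" by metis
  have bl: "bounded_linear T"
  proof (rule bounded_linear_intro[where K=K])
    show "T (z + w) = T z + T w" for z w by (rule G_unique[OF T G_add[OF T T]])
    show "T (r *\<^sub>R z) = r *\<^sub>R T z" for r z by (rule G_unique[OF T G_scale[OF T]])
    show "norm (T z) \<le> norm z * K" for z using bound[OF T[of z]] by (simp add: mult.commute)
  qed
  have app: "blinfun_apply (Blinfun T) z = T z" for z by (simp add: bounded_linear_Blinfun_apply[OF bl])
  have Tb: "blinfun_apply (Blinfun T) (x \<otimes> y) = \<beta> x y" for x y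
    unfolding app by (rule G_unique[OF T G_tensor])
  show ?thesis
  proof (rule that[of "Blinfun T"])
    show "blinfun_apply (Blinfun T) (x \<otimes> y) = \<beta> x y" for x y by (rule Tb)
    show "norm (Blinfun T) \<le> K" by (rule norm_blinfun_bound) (use K bound T in \<open>auto simp: app\<close>)
    fix T' :: "'a ptensor \<Rightarrow>\<^sub>L 'b" assume T': "\<And>x y. blinfun_apply T' (x \<otimes> y) = \<beta> x y"
    let ?S = "{z. blinfun_apply T' z = blinfun_apply (Blinfun T) z}"
    have "closed ?S"
      by (intro closed_Collect_eq continuous_intros)
    moreover have "span (range (\<lambda>(x, y). x \<otimes> y)) \<subseteq> ?S"
      by (rule span_minimal)
        (auto simp: T' Tb subspace_def blinfun.zero_right blinfun.add_right blinfun.scaleR_right)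
    ultimately have "closure (span (range (\<lambda>(x, y). x \<otimes> y))) \<subseteq> ?S"
      by (rule closure_minimal[rotated])
    then show "T' = Blinfun T"
      unfolding ptensor_dense by (intro blinfun_eqI) auto
  qed
qed

text \<open>The closed subspace spanned by the tensors \<open>u \<otimes> u\<close>, with \<open>tensor_sq u\<close> for \<open>u \<otimes> u\<close>.\<close>

typedef (overloaded) 'a symtensor =
  "closure (span (range (\<lambda>u. u \<otimes> u))) :: 'a::real_normed_vector ptensor set"
  using subspace_0[OF subspace_closure_span] by blast

setup_lifting type_definition_symtensor

instantiation symtensor :: (real_normed_vector) real_normed_vector
begin

lift_definition zero_symtensor :: "'a symtensor" is 0
  by (rule subspace_0[OF subspace_closure_span])
lift_definition plus_symtensor :: "'a symtensor \<Rightarrow> 'a symtensor \<Rightarrow> 'a symtensor" is "(+)"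
  by (rule subspace_add[OF subspace_closure_span])
lift_definition minus_symtensor :: "'a symtensor \<Rightarrow> 'a symtensor \<Rightarrow> 'a symtensor" is "(-)"
  by (rule subspace_diff[OF subspace_closure_span])
lift_definition uminus_symtensor :: "'a symtensor \<Rightarrow> 'a symtensor" is uminus
  by (rule subspace_neg[OF subspace_closure_span])
lift_definition scaleR_symtensor :: "real \<Rightarrow> 'a symtensor \<Rightarrow> 'a symtensor" is "(*\<^sub>R)"
  by (rule subspace_scale[OF subspace_closure_span])
lift_definition norm_symtensor :: "'a symtensor \<Rightarrow> real" is norm .
definition dist_symtensor :: "'a symtensor \<Rightarrow> 'a symtensor \<Rightarrow> real" where
  "dist_symtensor z w = norm (z - w)"
definition sgn_symtensor :: "'a symtensor \<Rightarrow> 'a symtensor" where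
  "sgn_symtensor z = scaleR (inverse (norm z)) z"
definition uniformity_symtensor :: "('a symtensor \<times> 'a symtensor) filter" where
  "uniformity_symtensor = (INF e\<in>{0 <..}. principal {(z, w :: 'a symtensor). dist z w < e})"
definition open_symtensor :: "'a symtensor set \<Rightarrow> bool" where
  "open_symtensor S = (\<forall>z\<in>S. \<forall>\<^sub>F (z', w) in uniformity. z' = z \<longrightarrow> w \<in> S)"

instance
proof
  fix a b :: real and u v w :: "'a symtensor" and U :: "'a symtensor set"
  show "u + v + w = u + (v + w)" "u + v = v + u" "0 + u = u" "- u + u = 0" "u - v = u + - v"
    by (transfer; simp)+
  show "a *\<^sub>R (u + v) = a *\<^sub>R u + a *\<^sub>R v" "(a + b) *\<^sub>R u = a *\<^sub>R u + b *\<^sub>R u"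
    "a *\<^sub>R b *\<^sub>R u = (a * b) *\<^sub>R u" "1 *\<^sub>R u = u"
    by (transfer; simp add: scaleR_add_left scaleR_add_right)+
  show "norm u = 0 \<longleftrightarrow> u = 0" "norm (u + v) \<le> norm u + norm v" "norm (a *\<^sub>R u) = \<bar>a\<bar> * norm u"
    by (transfer; simp add: norm_triangle_ineq)+
  show "dist u v = norm (u - v)" by (rule dist_symtensor_def)
  show "sgn u = scaleR (inverse (norm u)) u" by (rule sgn_symtensor_def)
  show "(uniformity :: ('a symtensor \<times> 'a symtensor) filter) = (INF e\<in>{0 <..}. principal {(u, v). dist u v < e})"
    by (rule uniformity_symtensor_def)
  show "open U = (\<forall>u\<in>U. \<forall>\<^sub>F (u', v) in uniformity. u' = u \<longrightarrow> v \<in> U)" by (rule open_symtensor_def)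
qed

end

lemma bounded_linear_Rep_symtensor: "bounded_linear Rep_symtensor"
  by (rule bounded_linear_intro[where K=1])
    (simp_all add: plus_symtensor.rep_eq scaleR_symtensor.rep_eq norm_symtensor.rep_eq)

instance symtensor :: (real_normed_vector) banach
proof
  fix X :: "nat \<Rightarrow> 'a symtensor" assume X: "Cauchy X"
  have d: "dist (Rep_symtensor x) (Rep_symtensor y) = dist x y" for x y :: "'a symtensor"
    by (simp add: dist_norm norm_symtensor.rep_eq minus_symtensor.rep_eq)
  have "Cauchy (\<lambda>n. Rep_symtensor (X n))"
    using X by (simp add: Cauchy_def d)
  then obtain l where l: "(\<lambda>n. Rep_symtensor (X n)) \<longlonglongrightarrow> l"
    by (auto simp: Cauchy_convergent_iff convergent_def)
  then obtain z :: "'a symtensor" where z: "l = Rep_symtensor z"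
    by (metis (no_types, lifting) Rep_symtensor Rep_symtensor_cases closed_closure closed_sequentially)
  have "X \<longlonglongrightarrow> z"
    using l unfolding z tendsto_iff d .
  then show "convergent X" by (auto simp: convergent_def)
qed


lift_definition tensor_sq :: "'a::real_normed_vector \<Rightarrow> 'a symtensor" is "\<lambda>u. u \<otimes> u"
  using closure_subset span_superset by fastforce

lemma symtensor_dense: "closure (span (range tensor_sq)) = (UNIV :: 'a::real_normed_vector symtensor set)"
proof -
  have "z \<in> closure (span (range tensor_sq))" for z :: "'a symtensor"
  proof -
    have "range (\<lambda>u. u \<otimes> u) = Rep_symtensor ` range (tensor_sq :: 'a \<Rightarrow> _)"
      by (simp add: image_image tensor_sq.rep_eq)
    then have eq: "span (range (\<lambda>u. u \<otimes> u)) = Rep_symtensor ` span (range (tensor_sq :: 'a \<Rightarrow> _))"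
      using linear_span_image[OF bounded_linear.linear[OF bounded_linear_Rep_symtensor]] by metis
    obtain f where f: "\<And>n::nat. f n \<in> span (range (\<lambda>u. u \<otimes> u))" "f \<longlonglongrightarrow> Rep_symtensor z"
      using Rep_symtensor[of z] by (auto simp: closure_sequential)
    then have "\<forall>n. \<exists>w. w \<in> span (range (tensor_sq :: 'a \<Rightarrow> _)) \<and> f n = Rep_symtensor w"
      unfolding eq by blast
    then obtain g where g: "\<And>n. g n \<in> span (range (tensor_sq :: 'a \<Rightarrow> _))" "\<And>n. f n = Rep_symtensor (g n)"
      by metis
    have d: "dist (Rep_symtensor x) (Rep_symtensor y) = dist x y" for x y :: "'a symtensor"
      by (simp add: dist_norm norm_symtensor.rep_eq minus_symtensor.rep_eq)
    have "g \<longlonglongrightarrow> z"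
      using f(2) unfolding tendsto_iff g(2) d .
    then show ?thesis
      using g(1) by (auto simp: closure_sequential)
  qed
  then show ?thesis by blast
qed

text \<open>
  The unique bounded linear map on the symmetric tensors with \<open>u \<otimes> u \<mapsto> F u\<close>. It exists whenever
  \<open>F\<close> is the diagonal of a bounded bilinear map into a Banach space (\<open>dilinear_lift_tensor_sq\<close>).
\<close>

definition dilinear_lift :: "('a::real_normed_vector \<Rightarrow> 'b::real_normed_vector) \<Rightarrow> 'a symtensor \<Rightarrow>\<^sub>L 'b" where
  "dilinear_lift F = (THE T. \<forall>u. blinfun_apply T (tensor_sq u) = F u)"

lemma symtensor_blinfun_eqI:
  fixes S T :: "'a::real_normed_vector symtensor \<Rightarrow>\<^sub>L 'b::real_normed_vector"
  assumes "\<And>u. blinfun_apply S (tensor_sq u) = blinfun_apply T (tensor_sq u)"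
  shows "S = T"
proof -
  let ?S = "{z. blinfun_apply S z = blinfun_apply T z}"
  have "closed ?S"
    by (intro closed_Collect_eq continuous_intros)
  moreover have "span (range tensor_sq) \<subseteq> ?S"
    by (rule span_minimal)
      (auto simp: assms subspace_def blinfun.zero_right blinfun.add_right blinfun.scaleR_right)
  ultimately have "closure (span (range tensor_sq)) \<subseteq> ?S"
    by (rule closure_minimal[rotated])
  then show ?thesis
    unfolding symtensor_dense by (intro blinfun_eqI) auto
qed

lemma dilinear_lift_tensor_sq:
  fixes \<beta> :: "'a::real_normed_vector \<Rightarrow> 'a \<Rightarrow> 'b::banach"
  assumes "bounded_bilinear \<beta>"
  shows "blinfun_apply (dilinear_lift (\<lambda>u. \<beta> u u)) (tensor_sq u) = \<beta> u u"
proof -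
  obtain K where K: "0 \<le> K" "\<And>x y. norm (\<beta> x y) \<le> norm x * norm y * K"
    using bounded_bilinear.nonneg_bounded[OF assms] by blast
  then have K': "norm (\<beta> x y) \<le> K * norm x * norm y" for x y
    by (simp add: mult_ac)
  obtain T :: "'a ptensor \<Rightarrow>\<^sub>L 'b" where T: "\<And>x y. blinfun_apply T (x \<otimes> y) = \<beta> x y"
    by (rule ptensor_universal[OF assms K' K(1)]) blast
  define S where "S = T o\<^sub>L Blinfun Rep_symtensor"
  have S: "blinfun_apply S (tensor_sq u) = \<beta> u u" for u
    by (simp add: S_def bounded_linear_Blinfun_apply[OF bounded_linear_Rep_symtensor] tensor_sq.rep_eq T)
  have "dilinear_lift (\<lambda>u. \<beta> u u) = S"
    unfolding dilinear_lift_def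
    by (rule the_equality) (auto simp: S intro: symtensor_blinfun_eqI)
  then show ?thesis by (simp add: S)
qed

section \<open>Adjoints and the dilinear subdifferential\<close>

text \<open>
  The adjoint of an operator from a normed space \<open>X\<close> to a Hilbert space \<open>Y\<close>, as a map from \<open>Y\<close>
  (identified with its dual) to the dual of \<open>X\<close>.
\<close>

definition dual_adjoint :: "('a::real_normed_vector \<Rightarrow>\<^sub>L 'b::real_inner) \<Rightarrow> 'b \<Rightarrow> 'a \<Rightarrow>\<^sub>L real" where
  "dual_adjoint T \<psi> = blinfun_inner_right \<psi> o\<^sub>L T"

definition dilinear_subdifferential ::
    "('a::real_normed_vector \<Rightarrow> ereal) \<Rightarrow> 'a \<Rightarrow> (('a \<Rightarrow>\<^sub>L real) \<times> ('a symtensor \<Rightarrow>\<^sub>L real)) set" (\<open>\<partial>\<^sub>\<beta>\<close>) where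
  "\<partial>\<^sub>\<beta> F u = {(\<xi>, \<Xi>). \<bar>F u\<bar> \<noteq> \<infinity> \<and>
     (\<forall>v. F v \<ge> F u + ereal (blinfun_apply \<xi> (v - u) + blinfun_apply \<Xi> (tensor_sq v - tensor_sq u)))}"

definition min_norm_solution :: "('a::real_normed_vector \<Rightarrow> 'b) \<Rightarrow> 'b \<Rightarrow> 'a \<Rightarrow> bool" where
  "min_norm_solution A g u \<longleftrightarrow> A u = g \<and> (\<forall>v. A v = g \<longrightarrow> norm u \<le> norm v)"


section \<open>Kernel-based autoconvolution\<close>

text \<open>
  As \<open>k\<close> stands for an essentially bounded class, all conditions on it hold almost everywhere
  on \<open>[0,1] \<times> [0,2]\<close>; its values elsewhere are never used.
\<close>

definition autoconv_kernel :: "(real \<Rightarrow> real \<Rightarrow> complex) \<Rightarrow> bool" where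
  "autoconv_kernel k \<longleftrightarrow>
     (\<lambda>(s, t). k s t) \<in> borel_measurable (lebesgue_on ({0..1} \<times> {0..2})) \<and>
     (\<exists>C. AE (s, t) in lebesgue_on ({0..1} \<times> {0..2}). cmod (k s t) \<le> C) \<and>
     (AE (s, t) in lebesgue_on ({0..1} \<times> {0..2}). \<not> (s \<le> t \<and> t \<le> s + 1) \<longrightarrow> k s t = 0) \<and>
     (AE (s, t) in lebesgue_on ({0..1} \<times> {0..2}). s \<le> t \<and> t \<le> s + 1 \<longrightarrow> k s t = k (t - s) t)"

definition autoconv :: "(real \<Rightarrow> real \<Rightarrow> complex) \<Rightarrow> 1 L2 \<Rightarrow> 2 L2" where
  "autoconv k u = L2_of (\<lambda>t. LINT s|lebesgue. k s t * L2_fun u s * L2_fun u (t - s))"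

text \<open>\<open>adj_I k \<phi>\<close> is the integral kernel written \<open>\<I>\<^sub>k\<^sup>*[\<phi>]\<close>, and \<open>Phi w\<close> the antilinear integral
  operator with kernel \<open>w\<close>.\<close>

definition adj_I :: "(real \<Rightarrow> real \<Rightarrow> complex) \<Rightarrow> 2 L2 \<Rightarrow> real \<Rightarrow> real \<Rightarrow> complex" where
  "adj_I k \<phi> s t = cnj (k s (s + t)) * L2_fun \<phi> (s + t)"

definition Phi :: "(real \<Rightarrow> real \<Rightarrow> complex) \<Rightarrow> 1 L2 \<Rightarrow> 1 L2" where
  "Phi w u = L2_of (\<lambda>t. LINT s:{0..1}|lebesgue. w s t * cnj (L2_fun u s))"

end

theory Submission
  imports Defs
begin

text \<open>
  Put \<open>H(s,r) = k(s,s+r)\<close> on \<open>[0,1]\<^sup>2\<close>; this kernel is bounded and symmetric. By Fubini and the shear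
  \<open>(s,r) \<mapsto> (s,s+r)\<close>, the real trilinear form
  \<open>b(u,v,\<phi>) = Re \<integral>\<integral> H(s,r) u(s) v(r) cnj (\<phi>(s+r)) ds dr\<close> satisfies
  \<open>\<langle>\<A>\<^sub>k[u], \<phi>\<rangle> = b(u,u,\<phi>)\<close> and \<open>\<langle>\<Phi>[u], v\<rangle> = b(u,v,\<phi>)\<close>, so that \<open>\<Phi>\<close> is bounded and
  self-adjoint over the reals.
  The source condition says that \<open>\<parallel>v\<parallel>\<^sup>2 - b(v,v,\<psi>)\<close> is minimal at \<open>v = u\<close>. By homogeneity this means
  \<open>b(v,v,\<psi>) \<le> \<parallel>v\<parallel>\<^sup>2\<close> for all \<open>v\<close>, with equality at \<open>u\<close>. As \<open>b(\<i>v,\<i>v,\<psi>) = - b(v,v,\<psi>)\<close>, the bound is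
  two-sided and gives \<open>\<parallel>\<Phi>\<parallel> \<le> 1\<close>; equality at \<open>u\<close> then forces \<open>\<Phi>[u] = u\<close>. If \<open>u = 0\<close>, any \<open>\<phi>\<close> with
  \<open>\<parallel>\<Phi>\<parallel> = 1\<close> will do, and a multiple of some \<open>\<phi>\<close> has this norm because \<open>k\<close> does not vanish a.e.
\<close>

section \<open>Borel representatives\<close>

text \<open>Real and imaginary part each agree almost everywhere with a real Borel function; the two
  are recombined.\<close>

lemma lebesgue_ex_borel_representative:
  fixes f :: "'a::euclidean_space \<Rightarrow> complex"
  assumes "f \<in> borel_measurable lebesgue"
  obtains g where "g \<in> borel_measurable borel" "AE x in lborel. f x = g x"
proof -
  have "(\<lambda>x. Re (f x)) \<in> borel_measurable lebesgue" "(\<lambda>x. Im (f x)) \<in> borel_measurable lebesgue"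
    using assms by simp_all
  from this[THEN completion_ex_borel_measurable_real]
  obtain p q where pq: "p \<in> borel_measurable lborel" "q \<in> borel_measurable lborel"
    "AE x in lborel. Re (f x) = p x" "AE x in lborel. Im (f x) = q x"
    by blast
  from pq(3,4) have "AE x in lborel. f x = Complex (p x) (q x)"
    by eventually_elim (simp add: complex_eq_iff)
  moreover have "(\<lambda>x. Complex (p x) (q x)) \<in> borel_measurable borel"
    using pq(1,2) by (simp add: borel_measurable_complex_iff)
  ultimately show ?thesis by (rule that[rotated])
qed

lemma measurable_cnj [measurable]: "cnj \<in> borel_measurable borel"
  by (intro borel_measurable_continuous_onI continuous_intros)

lemma AE_lebesgue_on_iff:
  "S \<in> sets lebesgue \<Longrightarrow> (AE x in lebesgue_on S. P x) \<longleftrightarrow> (AE x in lborel. x \<in> S \<longrightarrow> P x)"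
  by (subst AE_restrict_space_iff) (simp_all add: AE_completion_iff)

lemma AE_L2_measure:
  "(AE x in L2_measure TYPE('n). P x) \<longleftrightarrow> (AE x in lborel. x \<in> {0..real CARD('n)} \<longrightarrow> P x)"
  unfolding L2_measure_def by (rule AE_lebesgue_on_iff) simp

text \<open>Moves integrals from the interval to the whole line, so that Fubini and substitution for
  \<open>lborel\<close> apply to functions extended by zero.\<close>

lemma integral_L2_measure:
  fixes h :: "real \<Rightarrow> 'b::euclidean_space"
  assumes [measurable]: "h \<in> borel_measurable borel"
    and "\<And>x. x \<notin> {0..real CARD('n)} \<Longrightarrow> h x = 0"
  shows "integrable (L2_measure TYPE('n)) h \<longleftrightarrow> integrable lborel h"
    and "(\<integral>x. h x \<partial>L2_measure TYPE('n)) = (\<integral>x. h x \<partial>lborel)"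
proof -
  have eq: "indicat_real {0..real CARD('n)} x *\<^sub>R h x = h x" for x
    using assms(2) by (auto simp: indicator_def)
  show "integrable (L2_measure TYPE('n)) h \<longleftrightarrow> integrable lborel h"
    unfolding L2_measure_def by (subst integrable_restrict_space) (simp_all add: eq integrable_completion)
  show "(\<integral>x. h x \<partial>L2_measure TYPE('n)) = (\<integral>x. h x \<partial>lborel)"
    unfolding L2_measure_def by (subst integral_restrict_space) (simp_all add: eq integral_completion)
qed

text \<open>Fubini on the plane is applied to Borel functions, whereas \<open>L2_fun u\<close> is
  only Lebesgue measurable. Vanishing off the interval is required at every point, not just almost
  everywhere.\<close>

definition L2_borel :: "'n L2 \<Rightarrow> real \<Rightarrow> complex" where
  "L2_borel u = (SOME g. g \<in> borel_measurable borel \<and> (\<forall>x. x \<notin> {0..real CARD('n)} \<longrightarrow> g x = 0) \<and>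
     (AE x in lborel. L2_fun u x = g x))"

lemma L2_borel:
  fixes u :: "'n L2"
  shows L2_borel_measurable [measurable]: "L2_borel u \<in> borel_measurable borel"
    and L2_borel_outside: "x \<notin> {0..real CARD('n)} \<Longrightarrow> L2_borel u x = 0"
    and AE_L2_borel: "AE x in lborel. L2_fun u x = L2_borel u x"
proof -
  have "L2_rep u \<in> borel_measurable (lebesgue_on {0..real CARD('n)})"
    using sq_integrable_L2_rep[of u] by (simp add: sq_integrable_def L2_measure_def)
  then have "L2_fun u \<in> borel_measurable lebesgue"
    using borel_measurable_if_I[of "L2_rep u" "{0..real CARD('n)}"] by (simp add: L2_fun_def[abs_def])
  then obtain g where [measurable]: "g \<in> borel_measurable borel" and g: "AE x in lborel. L2_fun u x = g x"
    by (rule lebesgue_ex_borel_representative)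
  have "\<exists>g. g \<in> borel_measurable borel \<and> (\<forall>x. x \<notin> {0..real CARD('n)} \<longrightarrow> g x = 0) \<and>
     (AE x in lborel. L2_fun u x = g x)"
  proof (intro exI conjI)
    \<comment> \<open>\<open>L2_fun u\<close> is zero off the interval, so cutting \<open>g\<close>
      off there keeps the a.e. equality.\<close>
    show "(\<lambda>x. if x \<in> {0..real CARD('n)} then g x else 0) \<in> borel_measurable borel" by measurable
    show "AE x in lborel. L2_fun u x = (if x \<in> {0..real CARD('n)} then g x else 0)"
      using g by eventually_elim (auto simp: L2_fun_def)
  qed simp
  from someI_ex[OF this, folded L2_borel_def] show "L2_borel u \<in> borel_measurable borel"
    "x \<notin> {0..real CARD('n)} \<Longrightarrow> L2_borel u x = 0" "AE x in lborel. L2_fun u x = L2_borel u x"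
    by auto
qed

lemma L2_of_L2_borel:
  fixes u :: "'n L2"
  shows L2_of_borel: "L2_of (L2_borel u) = u"
    and integrable_L2_borel: "integrable lborel (\<lambda>x. (cmod (L2_borel u x))\<^sup>2)"
    and sq_integrable_L2_borel: "sq_integrable (L2_measure TYPE('n)) (L2_borel u)"
proof -
  let ?M = "L2_measure TYPE('n)"
  have ae: "AE x in ?M. L2_rep u x = L2_borel u x"
    unfolding AE_L2_measure using AE_L2_borel[of u] by eventually_elim (auto simp: L2_fun_def)
  have m: "L2_borel u \<in> borel_measurable ?M"
    unfolding L2_measure_def by (intro measurable_restrict_space1 measurable_completion) simp
  have r: "sq_integrable ?M (L2_rep u)" by (rule sq_integrable_L2_rep)
  have "integrable ?M (\<lambda>x. (cmod (L2_borel u x))\<^sup>2)"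
  proof (rule integrable_cong_AE_imp)
    show "integrable ?M (\<lambda>x. (cmod (L2_rep u x))\<^sup>2)" using r by (simp add: sq_integrable_def)
    show "(\<lambda>x. (cmod (L2_borel u x))\<^sup>2) \<in> borel_measurable ?M" using m by measurable
    show "AE x in ?M. (cmod (L2_rep u x))\<^sup>2 = (cmod (L2_borel u x))\<^sup>2"
      using ae by eventually_elim simp
  qed
  with m show sq: "sq_integrable ?M (L2_borel u)" by (simp add: sq_integrable_def)
  then show "integrable lborel (\<lambda>x. (cmod (L2_borel u x))\<^sup>2)"
    using integral_L2_measure(1)[where h="\<lambda>x. (cmod (L2_borel u x))\<^sup>2" and 'n='n]
    by (simp add: sq_integrable_def L2_borel_outside)
  have "L2_of (L2_rep u) = (L2_of (L2_borel u) :: 'n L2)"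
    using L2_of_eq_iff[OF r sq] ae by simp
  then show "L2_of (L2_borel u) = u" by (simp add: L2_of_rep)
qed

lemma inner_L2_borel:
  "inner u (v :: 'n L2) = Re (\<integral>x. L2_borel u x * cnj (L2_borel v x) \<partial>lborel)"
  by (subst L2_of_borel[of u, symmetric], subst L2_of_borel[of v, symmetric])
    (auto simp: inner_L2_of sq_integrable_L2_borel L2_borel_outside intro!: arg_cong[of _ _ Re] integral_L2_measure(2))

lemma norm_L2_borel: "(norm (u :: 'n L2))\<^sup>2 = (\<integral>x. (cmod (L2_borel u x))\<^sup>2 \<partial>lborel)"
proof -
  have "(norm u)\<^sup>2 = (norm (L2_of (L2_borel u) :: 'n L2))\<^sup>2" by (simp add: L2_of_borel)
  also have "\<dots> = (\<integral>x. (cmod (L2_borel u x))\<^sup>2 \<partial>lborel)"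
    unfolding norm_L2_of[OF sq_integrable_L2_borel]
    by (auto simp: L2_borel_outside intro!: integral_L2_measure(2))
  finally show ?thesis .
qed

lemma sq_integrable_L2_measureI:
  assumes "f \<in> borel_measurable borel" "integrable lborel (\<lambda>x. (cmod (f x))\<^sup>2)"
    "\<And>x. x \<notin> {0..real CARD('n)} \<Longrightarrow> f x = 0"
  shows "sq_integrable (L2_measure TYPE('n)) f"
proof -
  have "f \<in> borel_measurable (L2_measure TYPE('n))"
    unfolding L2_measure_def using assms(1) by (intro measurable_restrict_space1 measurable_completion) simp
  then show ?thesis
    using assms integral_L2_measure(1)[where h="\<lambda>x. (cmod (f x))\<^sup>2" and 'n='n] by (simp add: sq_integrable_def)
qed

text \<open>On the interval both functions represent the same class; off it both vanish, which
  extends the agreement to almost every point of the line.\<close>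

lemma AE_L2_borel_L2_of:
  assumes f: "f \<in> borel_measurable borel" "integrable lborel (\<lambda>x. (cmod (f x))\<^sup>2)"
    and out: "\<And>x. x \<notin> {0..real CARD('n)} \<Longrightarrow> f x = 0"
  shows "AE x in lborel. L2_borel (L2_of f :: 'n L2) x = f x"
proof -
  have "AE x in L2_measure TYPE('n). L2_borel (L2_of f :: 'n L2) x = f x"
    using L2_of_eq_iff[OF sq_integrable_L2_borel sq_integrable_L2_measureI[OF f out], of "L2_of f"]
    by (simp add: L2_of_borel)
  then show ?thesis
    unfolding AE_L2_measure by eventually_elim (metis L2_borel_outside out)
qed

lemma norm_L2_of_borel:
  assumes f: "f \<in> borel_measurable borel" "integrable lborel (\<lambda>x. (cmod (f x))\<^sup>2)"
    and out: "\<And>x. x \<notin> {0..real CARD('n)} \<Longrightarrow> f x = 0"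
  shows "(norm (L2_of f :: 'n L2))\<^sup>2 = (\<integral>x. (cmod (f x))\<^sup>2 \<partial>lborel)"
  unfolding norm_L2_borel
proof (rule integral_cong_AE)
  have "AE x in lborel. L2_borel (L2_of f :: 'n L2) x = f x"
    by (rule AE_L2_borel_L2_of[OF f out])
  then show "AE x in lborel. (cmod (L2_borel (L2_of f :: 'n L2) x))\<^sup>2 = (cmod (f x))\<^sup>2"
    by eventually_elim simp
qed (use f in measurable)

section \<open>Product Lebesgue measure and the shear of the plane\<close>

lemma measurable_shear [measurable]:
  "(\<lambda>(s, r). (s, c * s + r)) \<in> borel_measurable (borel :: (real \<times> real) measure)"
  unfolding case_prod_beta by (intro borel_measurable_continuous_onI continuous_intros)

text \<open>By Tonelli it suffices to look at sections: for fixed \<open>s\<close> the shear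
  translates by \<open>c * s\<close>, which preserves Lebesgue measure.\<close>

lemma distr_shear:
  fixes c :: real
  shows "distr (lborel :: (real \<times> real) measure) lborel (\<lambda>(s, r). (s, c * s + r)) = lborel"
proof (rule measure_eqI)
  fix A :: "(real \<times> real) set" assume "A \<in> sets (distr lborel lborel (\<lambda>(s, r). (s, c * s + r)))"
  then have [measurable]: "A \<in> sets (borel :: (real \<times> real) measure)" by simp
  then have [measurable]: "A \<in> sets (borel \<Otimes>\<^sub>M borel :: (real \<times> real) measure)" by (simp only: borel_prod)
  have "emeasure (distr lborel lborel (\<lambda>(s, r). (s, c * s + r))) A
      = (\<integral>\<^sup>+z. indicator A (case z of (s, r) \<Rightarrow> (s, c * s + r)) \<partial>lborel)"
    by (subst nn_integral_indicator[symmetric], simp, subst nn_integral_distr) simp_all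
  also have "\<dots> = (\<integral>\<^sup>+z. indicator A (case z of (s, r) \<Rightarrow> (s, c * s + r)) \<partial>(lborel \<Otimes>\<^sub>M lborel))"
    by (simp add: lborel_prod)
  also have "\<dots> = (\<integral>\<^sup>+s. \<integral>\<^sup>+r. indicator A (s, c * s + r) \<partial>lborel \<partial>lborel)"
    by (subst lborel.nn_integral_fst[symmetric]) simp_all
  also have "\<dots> = (\<integral>\<^sup>+s. \<integral>\<^sup>+r. indicator A (s, r) \<partial>lborel \<partial>lborel)"
  proof (rule nn_integral_cong)
    fix s :: real
    show "(\<integral>\<^sup>+r. indicator A (s, c * s + r) \<partial>lborel) = (\<integral>\<^sup>+r. indicator A (s, r) \<partial>lborel)"
      by (subst (2) lborel_distr_plus[of "c * s", symmetric], subst nn_integral_distr) simp_all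
  qed
  also have "\<dots> = (\<integral>\<^sup>+z. indicator A z \<partial>(lborel \<Otimes>\<^sub>M lborel))"
    by (subst lborel.nn_integral_fst[symmetric]) simp_all
  also have "\<dots> = emeasure lborel A"
    by (simp add: lborel_prod)
  finally show "emeasure (distr lborel lborel (\<lambda>(s, r). (s, c * s + r))) A = emeasure lborel A" .
qed simp

text \<open>A measure-preserving map pulls null sets back to null sets. The value
  \<open>c = 1\<close> passes from \<open>(s, t)\<close> to \<open>t = s + r\<close>, and
  \<open>c = -1\<close> goes back.\<close>

lemma AE_shear:
  fixes c :: real
  assumes "AE (s, t) in lborel. P s t"
  shows "AE (s, r) in lborel. P s (c * s + r)"
proof -
  have "AE z in distr (lborel :: (real \<times> real) measure) lborel (\<lambda>(s, r). (s, c * s + r)). case z of (s, t) \<Rightarrow> P s t"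
    unfolding distr_shear using assms .
  from AE_distrD[OF _ this] show ?thesis by (simp add: measurable_shear case_prod_beta)
qed

lemma AE_plane_swap:
  assumes "AE (s, t) in (lborel :: (real \<times> real) measure). P s t"
  shows "AE (t, s) in lborel. P s t"
proof -
  have "AE z in distr (lborel \<Otimes>\<^sub>M lborel) (lborel \<Otimes>\<^sub>M lborel) (\<lambda>(x, y). (y, x)).
      case z of (s, t) \<Rightarrow> P s t"
    using assms unfolding lborel_pair.distr_pair_swap[symmetric] by (simp only: lborel_prod)
  from AE_distrD[OF measurable_pair_swap' this] show ?thesis unfolding lborel_prod by (simp add: case_prod_beta)
qed

text \<open>The coordinates are swapped first because the integrals below run over \<open>s\<close>
  with the second variable fixed.\<close>

lemma AE_plane_sections:
  assumes "AE (s, t) in (lborel :: (real \<times> real) measure). P s t"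
  shows "AE t in lborel. AE s in lborel. P s t"
  using lborel_pair.AE_pair[of "\<lambda>(t, s). P s t"] AE_plane_swap[OF assms]
  unfolding lborel_prod by simp

lemma integral_shear:
  fixes f :: "real \<times> real \<Rightarrow> 'b::euclidean_space" and c :: real
  assumes [measurable]: "f \<in> borel_measurable borel"
  shows "integrable lborel (\<lambda>(s, r). f (s, c * s + r)) \<longleftrightarrow> integrable lborel f"
    and "(\<integral>(s, r). f (s, c * s + r) \<partial>lborel) = (\<integral>z. f z \<partial>lborel)"
proof -
  have eq: "(\<lambda>(s, r). f (s, c * s + r)) = (\<lambda>z. f (case z of (s, r) \<Rightarrow> (s, c * s + r)))"
    by (simp add: fun_eq_iff)
  show "integrable lborel (\<lambda>(s, r). f (s, c * s + r)) \<longleftrightarrow> integrable lborel f"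
    by (subst (2) distr_shear[of c, symmetric], subst integrable_distr_eq) (simp_all add: eq)
  show "(\<integral>(s, r). f (s, c * s + r) \<partial>lborel) = (\<integral>z. f z \<partial>lborel)"
    by (subst (2) distr_shear[of c, symmetric], subst integral_distr) (simp_all add: eq)
qed

lemma integrable_tensor:
  fixes p q :: "real \<Rightarrow> real"
  assumes "integrable lborel p" "integrable lborel q"
  shows "integrable lborel (\<lambda>(s, r). p s * q r)"
    and "(\<integral>(s, r). p s * q r \<partial>lborel) = (\<integral>s. p s \<partial>lborel) * (\<integral>r. q r \<partial>lborel)"
proof -
  have [measurable]: "p \<in> borel_measurable borel" "q \<in> borel_measurable borel"
    using assms[THEN borel_measurable_integrable] by simp_all
  have "integrable (lborel \<Otimes>\<^sub>M lborel) (\<lambda>(s, r). p s * q r)"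
  proof (rule lborel_pair.Fubini_integrable)
    show "integrable lborel (\<lambda>s. \<integral>r. norm (case (s, r) of (s, r) \<Rightarrow> p s * q r) \<partial>lborel)"
      using assms by (simp add: abs_mult)
    show "AE s in lborel. integrable lborel (\<lambda>r. case (s, r) of (s, r) \<Rightarrow> p s * q r)"
      using assms by simp
  qed measurable
  from lborel_pair.integral_fst'[OF this] this
  show "integrable lborel (\<lambda>(s, r). p s * q r)"
    "(\<integral>(s, r). p s * q r \<partial>lborel) = (\<integral>s. p s \<partial>lborel) * (\<integral>r. q r \<partial>lborel)"
    by (simp_all add: lborel_prod)
qed

lemma AE_plane_fst:
  assumes "AE s in lborel. P s"
  shows "AE (s, r) in (lborel :: (real \<times> real) measure). P s"
proof -
  obtain N where N: "N \<in> null_sets lborel" "{s. \<not> P s} \<subseteq> N"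
    using assms by (auto simp: eventually_ae_filter)
  have "N \<times> UNIV \<in> null_sets (lborel \<Otimes>\<^sub>M (lborel :: real measure))"
    using N(1) by (rule lborel.times_in_null_sets1) simp
  then show ?thesis
    unfolding lborel_prod by (rule AE_I') (use N(2) in auto)
qed

lemma AE_plane_snd:
  assumes "AE r in lborel. P r"
  shows "AE (s, r) in (lborel :: (real \<times> real) measure). P r"
  using AE_plane_swap[OF AE_plane_fst[OF assms]] .

section \<open>Integrability of products on the line\<close>

lemma integrable_bounded_support:
  fixes f :: "real \<Rightarrow> complex"
  assumes "f \<in> borel_measurable borel" "\<And>x. cmod (f x) \<le> K" "\<And>x. x \<notin> {0..b} \<Longrightarrow> f x = 0"
  shows "integrable lborel (\<lambda>x. (cmod (f x))\<^sup>2)"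
proof (rule Bochner_Integration.integrable_bound)
  show "integrable lborel (\<lambda>x. K\<^sup>2 * indicator {0..b} x :: real)"
    by (intro integrable_mult_right) (simp add: integrable_indicator_iff emeasure_lborel_Icc_eq)
  show "(\<lambda>x. (cmod (f x))\<^sup>2) \<in> borel_measurable lborel" using assms(1) by measurable
  show "AE x in lborel. norm ((cmod (f x))\<^sup>2) \<le> norm (K\<^sup>2 * indicator {0..b} x :: real)"
    using assms(2,3) by (intro AE_I2) (auto simp: indicator_def intro: power_mono)
qed

text \<open>By \<open>2 * a * b \<le> a^2 + b^2\<close>. Bounds of this additive kind suffice for
  integrability; the multiplicative bound is recovered later by scaling.\<close>

lemma norm_triple_mult_le:
  fixes w p q :: complex
  assumes "cmod w \<le> C"
  shows "cmod (w * p * q) \<le> C / 2 * ((cmod p)\<^sup>2 + (cmod q)\<^sup>2)"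
proof -
  have "0 \<le> C" using assms norm_ge_zero order_trans by blast
  have "cmod (w * p * q) = cmod w * (cmod p * cmod q)" by (simp add: norm_mult)
  also have "\<dots> \<le> C * (((cmod p)\<^sup>2 + (cmod q)\<^sup>2) / 2)"
    using assms \<open>0 \<le> C\<close> sum_squares_bound[of "cmod p" "cmod q"] by (intro mult_mono) auto
  finally show ?thesis by simp
qed

lemma integrable_triple_mult:
  fixes w p q :: "real \<Rightarrow> complex"
  assumes [measurable]: "w \<in> borel_measurable borel" "p \<in> borel_measurable borel" "q \<in> borel_measurable borel"
    and w: "\<And>s. cmod (w s) \<le> C"
    and p: "integrable lborel (\<lambda>s. (cmod (p s))\<^sup>2)" and q: "integrable lborel (\<lambda>s. (cmod (q s))\<^sup>2)"
  shows "integrable lborel (\<lambda>s. w s * p s * q s)"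
    and "cmod (\<integral>s. w s * p s * q s \<partial>lborel)
      \<le> C / 2 * ((\<integral>s. (cmod (p s))\<^sup>2 \<partial>lborel) + (\<integral>s. (cmod (q s))\<^sup>2 \<partial>lborel))"
proof -
  have D: "integrable lborel (\<lambda>s. C / 2 * ((cmod (p s))\<^sup>2 + (cmod (q s))\<^sup>2))"
    using p q by simp
  have "0 \<le> C" using w norm_ge_zero order_trans by blast
  then have le: "norm (w s * p s * q s) \<le> norm (C / 2 * ((cmod (p s))\<^sup>2 + (cmod (q s))\<^sup>2))" for s
    using norm_triple_mult_le[OF w[of s]] by (simp add: abs_mult)
  show int: "integrable lborel (\<lambda>s. w s * p s * q s)"
    by (rule Bochner_Integration.integrable_bound[OF D], measurable) (rule AE_I2[OF le])
  have "norm (\<integral>s. w s * p s * q s \<partial>lborel) \<le> (\<integral>s. C / 2 * ((cmod (p s))\<^sup>2 + (cmod (q s))\<^sup>2) \<partial>lborel)"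
    by (rule Bochner_Integration.integral_norm_bound_integral[OF int D]) (rule norm_triple_mult_le[OF w])
  then show "cmod (\<integral>s. w s * p s * q s \<partial>lborel)
      \<le> C / 2 * ((\<integral>s. (cmod (p s))\<^sup>2 \<partial>lborel) + (\<integral>s. (cmod (q s))\<^sup>2 \<partial>lborel))"
    using p q by simp
qed

lemma integral_reflect_shift:
  fixes f :: "real \<Rightarrow> 'b::euclidean_space"
  shows "integrable lborel (\<lambda>s. f (t - s)) \<longleftrightarrow> integrable lborel f"
    and "(\<integral>s. f (t - s) \<partial>lborel) = (\<integral>s. f s \<partial>lborel)"
  using lborel_integrable_real_affine_iff[of "-1" f t] lborel_integral_real_affine[of "-1" f t] by simp_all

lemma integral_shift:
  fixes f :: "real \<Rightarrow> 'b::euclidean_space"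
  shows "integrable lborel (\<lambda>s. f (s + t)) \<longleftrightarrow> integrable lborel f"
    and "(\<integral>s. f (s + t) \<partial>lborel) = (\<integral>s. f s \<partial>lborel)"
  using lborel_integrable_real_affine_iff[of 1 f t] lborel_integral_real_affine[of 1 f t] by (simp_all add: add.commute)

section \<open>The trilinear form of a symmetric kernel\<close>

text \<open>\<open>H s r\<close> is a Borel version of \<open>k s (s + r)\<close> on the unit
  square. All conditions hold pointwise, so no exceptional sets occur; in these coordinates the
  symmetry \<open>k s t = k (t - s) t\<close> becomes \<open>H_commute\<close>.\<close>

locale square_kernel =
  fixes H :: "real \<Rightarrow> real \<Rightarrow> complex" and C :: real
  assumes measurable_H: "(\<lambda>(s, r). H s r) \<in> borel_measurable borel"
    and norm_H_le: "cmod (H s r) \<le> C"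
    and H_outside: "s \<notin> {0..1} \<or> r \<notin> {0..1} \<Longrightarrow> H s r = 0"
    and H_commute: "H s r = H r s"
begin

lemma measurable_H_pair [measurable]: "(\<lambda>(s, r). H s r) \<in> borel_measurable (borel \<Otimes>\<^sub>M borel)"
  using measurable_H by (simp only: borel_prod)

lemma C_nonneg: "0 \<le> C"
  using norm_H_le[of 0 0] norm_ge_zero order_trans by blast

text \<open>The integrand is dominated by a multiple of
  \<open>|f s|^2 * |g r|^2 + indicator {0..1} s * |h (s + r)|^2\<close>. The first summand is a
  product, and the shear makes the second one a product too. The indicator may be inserted because
  \<open>H s r = 0\<close> for \<open>s\<close> outside the unit interval, and it contributes the
  factor 1 to the integral.\<close>

lemma integrable_kernel_product:
  assumes [measurable]: "f \<in> borel_measurable borel" "g \<in> borel_measurable borel" "h \<in> borel_measurable borel"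
    and f: "integrable lborel (\<lambda>s. (cmod (f s))\<^sup>2)" and g: "integrable lborel (\<lambda>s. (cmod (g s))\<^sup>2)"
    and h: "integrable lborel (\<lambda>s. (cmod (h s))\<^sup>2)"
  shows "integrable lborel (\<lambda>(s, r). H s r * f s * g r * h (s + r))"
    and "cmod (\<integral>(s, r). H s r * f s * g r * h (s + r) \<partial>lborel)
      \<le> C / 2 * ((\<integral>s. (cmod (f s))\<^sup>2 \<partial>lborel) * (\<integral>s. (cmod (g s))\<^sup>2 \<partial>lborel) + (\<integral>s. (cmod (h s))\<^sup>2 \<partial>lborel))"
proof -
  let ?G = "\<lambda>(s, r). H s r * f s * g r * h (s + r)"
  let ?E = "\<lambda>(s, r). indicator {0..1::real} s * (cmod (h r))\<^sup>2 :: real"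
  let ?D = "\<lambda>z. C / 2 * ((case z of (s, r) \<Rightarrow> (cmod (f s))\<^sup>2 * (cmod (g r))\<^sup>2) + (case z of (s, r) \<Rightarrow> ?E (s, 1 * s + r)))"
  have E: "?E \<in> borel_measurable borel"
    unfolding borel_prod[symmetric] by measurable
  have i: "integrable lborel (indicator {0..1::real} :: real \<Rightarrow> real)" by simp
  note E' = integral_shear[OF E, of 1] integrable_tensor[OF i h]
  have D: "integrable lborel ?D"
    using integrable_tensor(1)[OF f g] E' by (intro integrable_mult_right Bochner_Integration.integrable_add) auto
  have ID: "integral\<^sup>L lborel ?D
      = C / 2 * ((\<integral>s. (cmod (f s))\<^sup>2 \<partial>lborel) * (\<integral>s. (cmod (g s))\<^sup>2 \<partial>lborel) + (\<integral>s. (cmod (h s))\<^sup>2 \<partial>lborel))"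
    using integrable_tensor[OF f g] E' by (subst integral_mult_right_zero, subst Bochner_Integration.integral_add) auto
  have le: "norm (?G z) \<le> ?D z" for z
  proof (cases z)
    case (Pair s r)
    show ?thesis
    proof (cases "s \<in> {0..1}")
      case True
      then show ?thesis
        using norm_triple_mult_le[OF norm_H_le[of s r], of "f s * g r" "h (s + r)"]
        by (simp add: Pair norm_mult power_mult_distrib mult.assoc)
    next
      case False
      then show ?thesis using C_nonneg by (simp add: Pair H_outside)
    qed
  qed
  have D0: "0 \<le> ?D z" for z using le[of z] norm_ge_zero order_trans by blast
  have "?G \<in> borel_measurable lborel"
    unfolding lborel_prod[symmetric] by measurable
  then show int: "integrable lborel ?G"
    by (rule Bochner_Integration.integrable_bound[OF D])
      (use le D0 in \<open>auto intro!: AE_I2 simp del: split_paired_All simp: abs_of_nonneg\<close>)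
  show "cmod (\<integral>(s, r). H s r * f s * g r * h (s + r) \<partial>lborel)
      \<le> C / 2 * ((\<integral>s. (cmod (f s))\<^sup>2 \<partial>lborel) * (\<integral>s. (cmod (g s))\<^sup>2 \<partial>lborel) + (\<integral>s. (cmod (h s))\<^sup>2 \<partial>lborel))"
    using Bochner_Integration.integral_norm_bound_integral[OF int D] le unfolding ID by blast
qed

definition form :: "1 L2 \<Rightarrow> 1 L2 \<Rightarrow> 2 L2 \<Rightarrow> real" where
  "form u v \<phi> = Re (\<integral>(s, r). H s r * L2_borel u s * L2_borel v r * cnj (L2_borel \<phi> (s + r)) \<partial>lborel)"

text \<open>The autoconvolution integral, polarised to two arguments and written with Borel
  representatives.\<close>

definition conv :: "1 L2 \<Rightarrow> 1 L2 \<Rightarrow> real \<Rightarrow> complex" where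
  "conv u v t = (\<integral>s. H s (t - s) * L2_borel u s * L2_borel v (t - s) \<partial>lborel)"

text \<open>The integral that defines \<open>Phi (adj_I k \<phi>) u\<close>, written with Borel
  representatives.\<close>

definition adj :: "2 L2 \<Rightarrow> 1 L2 \<Rightarrow> real \<Rightarrow> complex" where
  "adj \<phi> u r = (\<integral>s. cnj (H s r) * L2_borel \<phi> (s + r) * cnj (L2_borel u s) \<partial>lborel)"

section \<open>The form as an inner product with \<open>conv\<close> and with
  \<open>adj\<close>\<close>

lemma integrable_form:
  "integrable lborel (\<lambda>(s, r). H s r * L2_borel u s * L2_borel v r * cnj (L2_borel \<phi> (s + r)))"
  using integrable_kernel_product(1)[of "L2_borel u" "L2_borel v" "\<lambda>t. cnj (L2_borel \<phi> t)"]
  by (simp add: integrable_L2_borel)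

text \<open>\<open>conv u v\<close> is bounded, since reflection and translation leave the norm of
  \<open>v\<close> unchanged, and it has bounded support: for \<open>t\<close> outside
  \<open>[0,2]\<close>, the points \<open>s\<close> and \<open>t - s\<close> cannot both lie in
  \<open>[0,1]\<close>.\<close>

lemma conv_square_integrable:
  shows measurable_conv: "conv u v \<in> borel_measurable borel"
    and integrable_conv: "integrable lborel (\<lambda>t. (cmod (conv u v t))\<^sup>2)"
    and conv_outside: "t \<notin> {0..real CARD(2)} \<Longrightarrow> conv u v t = 0"
proof -
  show m: "conv u v \<in> borel_measurable borel"
    unfolding conv_def[abs_def] by measurable
  have out: "conv u v t = 0" if "t \<notin> {0..real CARD(2)}" for t
  proof -
    have "H s (t - s) = 0" for s using that by (intro H_outside) auto
    then show ?thesis by (simp add: conv_def)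
  qed
  then show "t \<notin> {0..real CARD(2)} \<Longrightarrow> conv u v t = 0" .
  have "cmod (conv u v t) \<le> C / 2 * ((norm u)\<^sup>2 + (norm v)\<^sup>2)" for t
    using integrable_triple_mult(2)[of "\<lambda>s. H s (t - s)" "L2_borel u" "\<lambda>s. L2_borel v (t - s)" C]
    by (simp add: conv_def norm_L2_borel norm_H_le integrable_L2_borel
        integral_reflect_shift[of "\<lambda>s. (cmod (L2_borel v s))\<^sup>2"])
  then show "integrable lborel (\<lambda>t. (cmod (conv u v t))\<^sup>2)"
    by (rule integrable_bounded_support[OF m _ out])
qed

lemma adj_square_integrable:
  shows measurable_adj: "adj \<phi> u \<in> borel_measurable borel"
    and integrable_adj: "integrable lborel (\<lambda>t. (cmod (adj \<phi> u t))\<^sup>2)"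
    and adj_outside: "r \<notin> {0..real CARD(1)} \<Longrightarrow> adj \<phi> u r = 0"
proof -
  show m: "adj \<phi> u \<in> borel_measurable borel"
    unfolding adj_def[abs_def] by measurable
  have out: "adj \<phi> u r = 0" if "r \<notin> {0..real CARD(1)}" for r
    using that by (simp add: adj_def H_outside)
  then show "r \<notin> {0..real CARD(1)} \<Longrightarrow> adj \<phi> u r = 0" .
  have "cmod (adj \<phi> u r) \<le> C / 2 * ((norm \<phi>)\<^sup>2 + (norm u)\<^sup>2)" for r
    using integrable_triple_mult(2)[of "\<lambda>s. cnj (H s r)" "\<lambda>s. L2_borel \<phi> (s + r)" "\<lambda>s. cnj (L2_borel u s)" C]
    by (simp add: adj_def norm_L2_borel norm_H_le integrable_L2_borel
        integral_shift[of "\<lambda>s. (cmod (L2_borel \<phi> s))\<^sup>2"])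
  then show "integrable lborel (\<lambda>r. (cmod (adj \<phi> u r))\<^sup>2)"
    by (rule integrable_bounded_support[OF m _ out])
qed

text \<open>Fubini in the coordinates \<open>(s, t)\<close>, followed by the shear
  \<open>t = s + r\<close>.\<close>

lemma inner_conv: "inner (L2_of (conv u v)) \<phi> = form u v \<phi>"
proof -
  let ?G = "\<lambda>(s, t). H s (t - s) * L2_borel u s * L2_borel v (t - s) * cnj (L2_borel \<phi> t)"
  have G: "?G \<in> borel_measurable borel"
    unfolding borel_prod[symmetric] by measurable
  have int: "integrable (lborel \<Otimes>\<^sub>M lborel) ?G"
    using integral_shear(1)[OF G, of 1] integrable_form[of u v \<phi>] by (simp add: lborel_prod)
  have "inner (L2_of (conv u v)) \<phi> = Re (\<integral>t. L2_borel (L2_of (conv u v) :: 2 L2) t * cnj (L2_borel \<phi> t) \<partial>lborel)"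
    by (rule inner_L2_borel)
  also have "(\<integral>t. L2_borel (L2_of (conv u v) :: 2 L2) t * cnj (L2_borel \<phi> t) \<partial>lborel)
      = (\<integral>t. conv u v t * cnj (L2_borel \<phi> t) \<partial>lborel)"
  proof (rule integral_cong_AE)
    have "AE t in lborel. L2_borel (L2_of (conv u v) :: 2 L2) t = conv u v t"
      by (rule AE_L2_borel_L2_of[OF conv_square_integrable])
    then show "AE t in lborel. L2_borel (L2_of (conv u v) :: 2 L2) t * cnj (L2_borel \<phi> t) = conv u v t * cnj (L2_borel \<phi> t)"
      by eventually_elim simp
  qed (use measurable_conv[of u v] in measurable)
  also have "\<dots> = (\<integral>t. (\<integral>s. ?G (s, t) \<partial>lborel) \<partial>lborel)"
    by (simp add: conv_def)
  also have "\<dots> = (\<integral>z. ?G z \<partial>lborel)"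
    using lborel_pair.integral_snd[of "\<lambda>s t. ?G (s, t)"] int by (simp add: lborel_prod)
  also have "\<dots> = (\<integral>(s, r). H s r * L2_borel u s * L2_borel v r * cnj (L2_borel \<phi> (s + r)) \<partial>lborel)"
    using integral_shear(2)[OF G, of 1] by simp
  finally show ?thesis by (simp add: form_def)
qed

text \<open>By Fubini the complex inner product is the conjugate of the integral in
  \<open>form\<close>, and conjugation does not change the real part. Together with
  \<open>form_commute\<close> this makes \<open>adj \<phi>\<close> self-adjoint over the
  reals.\<close>

lemma inner_adj: "inner (L2_of (adj \<phi> u)) v = form u v \<phi>"
proof -
  let ?G = "\<lambda>(s, r). H s r * L2_borel u s * L2_borel v r * cnj (L2_borel \<phi> (s + r))"
  have int: "integrable (lborel \<Otimes>\<^sub>M lborel) (\<lambda>z. cnj (?G z))"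
    using integrable_form[of u v \<phi>] by (simp add: lborel_prod)
  have "inner (L2_of (adj \<phi> u)) v = Re (\<integral>r. L2_borel (L2_of (adj \<phi> u) :: 1 L2) r * cnj (L2_borel v r) \<partial>lborel)"
    by (rule inner_L2_borel)
  also have "(\<integral>r. L2_borel (L2_of (adj \<phi> u) :: 1 L2) r * cnj (L2_borel v r) \<partial>lborel)
      = (\<integral>r. adj \<phi> u r * cnj (L2_borel v r) \<partial>lborel)"
  proof (rule integral_cong_AE)
    have "AE r in lborel. L2_borel (L2_of (adj \<phi> u) :: 1 L2) r = adj \<phi> u r"
      by (rule AE_L2_borel_L2_of[OF adj_square_integrable])
    then show "AE r in lborel. L2_borel (L2_of (adj \<phi> u) :: 1 L2) r * cnj (L2_borel v r) = adj \<phi> u r * cnj (L2_borel v r)"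
      by eventually_elim simp
  qed (use measurable_adj[of \<phi> u] in measurable)
  also have "\<dots> = (\<integral>r. (\<integral>s. cnj (?G (s, r)) \<partial>lborel) \<partial>lborel)"
    unfolding adj_def by (subst integral_mult_left_zero[symmetric]) (simp add: mult_ac)
  also have "\<dots> = (\<integral>z. cnj (?G z) \<partial>lborel)"
    using lborel_pair.integral_snd[of "\<lambda>s t. cnj (?G (s, t))"] int by (simp add: lborel_prod case_prod_unfold)
  also have "\<dots> = cnj (\<integral>z. ?G z \<partial>lborel)"
    by (rule Bochner_Integration.integral_cnj)
  finally show ?thesis by (simp add: form_def)
qed

text \<open>Swapping \<open>s\<close> and \<open>r\<close> changes neither \<open>H s r\<close> nor
  \<open>s + r\<close>.\<close>

lemma form_commute: "form u v \<phi> = form v u \<phi>"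
proof -
  let ?G = "\<lambda>(s, r). H s r * L2_borel u s * L2_borel v r * cnj (L2_borel \<phi> (s + r))"
  have "(\<integral>(s, r). ?G (r, s) \<partial>(lborel \<Otimes>\<^sub>M lborel)) = (\<integral>z. ?G z \<partial>(lborel \<Otimes>\<^sub>M lborel))"
    by (rule lborel_pair.integral_product_swap) measurable
  moreover have "(\<lambda>(s, r). ?G (r, s)) = (\<lambda>(s, r). H s r * L2_borel v s * L2_borel u r * cnj (L2_borel \<phi> (s + r)))"
    using H_commute by (auto simp: fun_eq_iff mult_ac add.commute)
  ultimately show ?thesis by (simp add: form_def lborel_prod)
qed

section \<open>Trilinearity and boundedness\<close>

lemma abs_form_le: "\<bar>form u v \<phi>\<bar> \<le> C / 2 * ((norm u)\<^sup>2 * (norm v)\<^sup>2 + (norm \<phi>)\<^sup>2)"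
proof -
  have "\<bar>form u v \<phi>\<bar> \<le> cmod (\<integral>(s, r). H s r * L2_borel u s * L2_borel v r * cnj (L2_borel \<phi> (s + r)) \<partial>lborel)"
    unfolding form_def by (rule abs_Re_le_cmod)
  also have "\<dots> \<le> C / 2 * ((norm u)\<^sup>2 * (norm v)\<^sup>2 + (norm \<phi>)\<^sup>2)"
    using integrable_kernel_product(2)[of "L2_borel u" "L2_borel v" "\<lambda>t. cnj (L2_borel \<phi> t)"]
    by (simp add: integrable_L2_borel norm_L2_borel)
  finally show ?thesis .
qed

text \<open>The chosen representatives \<open>L2_borel\<close> are additive only almost everywhere.
  Reading the form as an inner product avoids them: \<open>inner_conv\<close> gives linearity in the
  third argument, \<open>inner_adj\<close> in the second, and symmetry transfers it to the
  first.\<close>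

lemma form_linear:
  shows form_add3: "form u v (\<phi> + \<psi>) = form u v \<phi> + form u v \<psi>"
    and form_scaleR3: "form u v (c *\<^sub>R \<phi>) = c * form u v \<phi>"
    and form_add2: "form u (v + w) \<phi> = form u v \<phi> + form u w \<phi>"
    and form_scaleR2: "form u (c *\<^sub>R v) \<phi> = c * form u v \<phi>"
    and form_add1: "form (u + w) v \<phi> = form u v \<phi> + form w v \<phi>"
    and form_scaleR1: "form (c *\<^sub>R u) v \<phi> = c * form u v \<phi>"
proof -
  show "form u v (\<phi> + \<psi>) = form u v \<phi> + form u v \<psi>" "form u v (c *\<^sub>R \<phi>) = c * form u v \<phi>"
    by (simp_all only: inner_conv[symmetric] inner_add_right inner_scaleR_right)
  show 2: "form u (v + w) \<phi> = form u v \<phi> + form u w \<phi>" "form u (c *\<^sub>R v) \<phi> = c * form u v \<phi>" for u v w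
    by (simp_all only: inner_adj[symmetric] inner_add_right inner_scaleR_right)
  show "form (u + w) v \<phi> = form u v \<phi> + form w v \<phi>" "form (c *\<^sub>R u) v \<phi> = c * form u v \<phi>"
    using 2[of v] by (simp_all only: form_commute[of _ v])
qed

text \<open>At unit vectors the additive bound \<open>abs_form_le\<close> equals \<open>C\<close>;
  trilinearity scales this to arbitrary arguments.\<close>

lemma abs_form_le_norms: "\<bar>form u v \<phi>\<bar> \<le> C * norm u * norm v * norm \<phi>"
proof (cases "u = 0 \<or> v = 0 \<or> \<phi> = 0")
  case True
  then show ?thesis
    using form_scaleR1[of 0 u v \<phi>] form_scaleR2[of u 0 v \<phi>] form_scaleR3[of u v 0 \<phi>] by auto
next
  case False
  have sgn: "norm x *\<^sub>R sgn x = x" for x :: "'n L2"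
    by (cases "x = 0") (simp_all add: sgn_div_norm)
  have "form u v \<phi> = form (norm u *\<^sub>R sgn u) (norm v *\<^sub>R sgn v) (norm \<phi> *\<^sub>R sgn \<phi>)"
    by (simp only: sgn)
  also have "\<dots> = norm u * norm v * norm \<phi> * form (sgn u) (sgn v) (sgn \<phi>)"
    by (simp only: form_linear mult_ac)
  finally have "\<bar>form u v \<phi>\<bar> = norm u * norm v * norm \<phi> * \<bar>form (sgn u) (sgn v) (sgn \<phi>)\<bar>"
    by (simp add: abs_mult)
  also have "\<dots> \<le> norm u * norm v * norm \<phi> * C"
    using abs_form_le[of "sgn u" "sgn v" "sgn \<phi>"] False by (intro mult_left_mono) (auto simp: norm_sgn)
  finally show ?thesis by (simp add: mult_ac)
qed

text \<open>The identities are tested against every \<open>\<phi>\<close> and so reduce to those of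
  \<open>form\<close>; the norm bound comes from testing \<open>conv a b\<close> against itself.
  Bilinearity is what \<open>dilinear_lift_tensor_sq\<close> asks for.\<close>

lemma bounded_bilinear_conv: "bounded_bilinear (\<lambda>u v. L2_of (conv u v) :: 2 L2)"
proof
  fix a a' b b' :: "1 L2" and c :: real
  show "L2_of (conv (a + a') b) = (L2_of (conv a b) + L2_of (conv a' b) :: 2 L2)"
    by (rule vector_eq_rdot[THEN iffD1]) (simp add: inner_conv inner_add_left form_linear)
  show "L2_of (conv a (b + b')) = (L2_of (conv a b) + L2_of (conv a b') :: 2 L2)"
    by (rule vector_eq_rdot[THEN iffD1]) (simp add: inner_conv inner_add_left form_linear)
  show "L2_of (conv (c *\<^sub>R a) b) = (c *\<^sub>R L2_of (conv a b) :: 2 L2)"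
    by (rule vector_eq_rdot[THEN iffD1]) (simp add: inner_conv form_linear)
  show "L2_of (conv a (c *\<^sub>R b)) = (c *\<^sub>R L2_of (conv a b) :: 2 L2)"
    by (rule vector_eq_rdot[THEN iffD1]) (simp add: inner_conv form_linear)
  have "norm (L2_of (conv a b) :: 2 L2) \<le> norm a * norm b * C" for a b
  proof -
    let ?w = "L2_of (conv a b) :: 2 L2"
    have "norm ?w * norm ?w = form a b ?w"
      by (simp add: inner_conv[symmetric] power2_norm_eq_inner[symmetric] power2_eq_square)
    also have "\<dots> \<le> (norm a * norm b * C) * norm ?w"
      using abs_form_le_norms[of a b ?w] by (simp add: mult_ac)
    finally show ?thesis
      by (cases "norm ?w = 0") (simp_all add: C_nonneg)
  qed
  then show "\<exists>K. \<forall>a b. norm (L2_of (conv a b) :: 2 L2) \<le> norm a * norm b * K" by blast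
qed

lemma bounded_linear_adj: "bounded_linear (\<lambda>u. L2_of (adj \<phi> u) :: 1 L2)"
proof (rule bounded_linear_intro[where K="C * norm \<phi>"])
  fix a b :: "1 L2" and c :: real
  show "L2_of (adj \<phi> (a + b)) = (L2_of (adj \<phi> a) + L2_of (adj \<phi> b) :: 1 L2)"
    by (rule vector_eq_rdot[THEN iffD1]) (simp add: inner_adj inner_add_left form_linear)
  show "L2_of (adj \<phi> (c *\<^sub>R a)) = (c *\<^sub>R L2_of (adj \<phi> a) :: 1 L2)"
    by (rule vector_eq_rdot[THEN iffD1]) (simp add: inner_adj form_linear)
  let ?w = "L2_of (adj \<phi> a) :: 1 L2"
  have "norm ?w * norm ?w = form a ?w \<phi>"
    by (simp add: inner_adj[symmetric] power2_norm_eq_inner[symmetric] power2_eq_square)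
  also have "\<dots> \<le> (norm a * (C * norm \<phi>)) * norm ?w"
    using abs_form_le_norms[of a ?w \<phi>] by (simp add: mult_ac)
  finally show "norm ?w \<le> norm a * (C * norm \<phi>)"
    by (cases "norm ?w = 0") (simp_all add: C_nonneg)
qed

lemma adj_scaleR: "L2_of (adj (c *\<^sub>R \<phi>) u) = (c *\<^sub>R L2_of (adj \<phi> u) :: 1 L2)"
  by (rule vector_eq_rdot[THEN iffD1]) (simp add: inner_adj form_linear)

text \<open>Rotation by \<open>\<i>\<close> changes the sign of the form, so an upper bound for it is a two-sided bound.\<close>

definition rot :: "1 L2 \<Rightarrow> 1 L2" where
  "rot u = L2_of (\<lambda>x. \<i> * L2_borel u x)"

lemma AE_rot: "AE x in lborel. L2_borel (rot u) x = \<i> * L2_borel u x"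
  unfolding rot_def
  by (rule AE_L2_borel_L2_of) (auto simp: norm_mult integrable_L2_borel L2_borel_outside)

lemma norm_rot: "norm (rot u) = norm u"
proof -
  have "(norm (rot u))\<^sup>2 = (\<integral>x. (cmod (\<i> * L2_borel u x))\<^sup>2 \<partial>lborel)"
    unfolding rot_def
    by (rule norm_L2_of_borel) (auto simp: norm_mult integrable_L2_borel L2_borel_outside)
  also have "\<dots> = (norm u)\<^sup>2" by (simp add: norm_mult norm_L2_borel)
  finally show ?thesis by simp
qed

text \<open>The form is complex bilinear under the real part in its first two arguments, so the two
  rotations contribute \<open>\<i> * \<i> = -1\<close>.\<close>

lemma form_rot: "form (rot u) (rot v) \<phi> = - form u v \<phi>"
proof -
  have "(\<integral>(s, r). H s r * L2_borel (rot u) s * L2_borel (rot v) r * cnj (L2_borel \<phi> (s + r)) \<partial>lborel)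
      = (\<integral>z. - (case z of (s, r) \<Rightarrow> H s r * L2_borel u s * L2_borel v r * cnj (L2_borel \<phi> (s + r))) \<partial>lborel)"
  proof (rule integral_cong_AE)
    have "AE (s, r::real) in lborel. L2_borel (rot u) s = \<i> * L2_borel u s"
      by (rule AE_plane_fst[OF AE_rot])
    moreover have "AE (s::real, r) in lborel. L2_borel (rot v) r = \<i> * L2_borel v r"
      by (rule AE_plane_snd[OF AE_rot])
    ultimately show "AE z in lborel. (case z of (s, r) \<Rightarrow> H s r * L2_borel (rot u) s * L2_borel (rot v) r * cnj (L2_borel \<phi> (s + r)))
      = - (case z of (s, r) \<Rightarrow> H s r * L2_borel u s * L2_borel v r * cnj (L2_borel \<phi> (s + r)))"
      by eventually_elim (auto simp: algebra_simps)
  qed (use borel_measurable_integrable[OF integrable_form] in \<open>auto intro!: borel_measurable_uminus\<close>)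
  then show ?thesis by (simp add: form_def)
qed

section \<open>A vanishing form has a vanishing kernel\<close>

lemma integrable_H: "integrable (lborel \<Otimes>\<^sub>M lborel) (\<lambda>(s, r). H s r)"
proof (rule Bochner_Integration.integrable_bound)
  have "integrable lborel (indicator {0..1::real} :: real \<Rightarrow> real)" by simp
  from integrable_tensor(1)[OF this this]
  show "integrable (lborel \<Otimes>\<^sub>M lborel) (\<lambda>z. C * (case z of (s, r) \<Rightarrow> indicator {0..1::real} s * indicator {0..1::real} r))"
    by (simp add: lborel_prod)
  show "AE z in lborel \<Otimes>\<^sub>M lborel. norm (case z of (s, r) \<Rightarrow> H s r)
      \<le> norm (C * (case z of (s, r) \<Rightarrow> indicator {0..1::real} s * indicator {0..1::real} r))"
    using norm_H_le C_nonneg by (intro AE_I2) (auto simp: indicator_def H_outside)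
qed measurable

lemma integral_H_times:
  assumes form: "\<And>u v \<phi>. form u v \<phi> = 0"
    and [measurable]: "A \<in> sets borel" "B \<in> sets borel"
  shows "(\<integral>z. indicator (A \<times> B) z *\<^sub>R (case z of (s, r) \<Rightarrow> H s r) \<partial>(lborel \<Otimes>\<^sub>M lborel)) = 0"
proof -
  let ?I = "\<integral>z. indicator (A \<times> B) z *\<^sub>R (case z of (s, r) \<Rightarrow> H s r) \<partial>(lborel \<Otimes>\<^sub>M lborel)"
  have Re0: "Re (c * ?I) = 0" for c :: complex
  proof -
    \<comment> \<open>Indicators serve as test functions. As \<open>h\<close> equals 1 at
      \<open>s + r\<close> for all \<open>s\<close>, \<open>r\<close> in the unit interval, the form
      becomes the real part of \<open>c\<close> times the integral of \<open>H\<close> over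
      \<open>A \<times> B\<close>.\<close>
    define f where "f x = c * indicator (A \<inter> {0..1}) x" for x :: real
    define g :: "real \<Rightarrow> complex" where "g x = indicator (B \<inter> {0..1}) x" for x
    define h :: "real \<Rightarrow> complex" where "h x = indicator {0..2} x" for x
    have [measurable]: "f \<in> borel_measurable borel" "g \<in> borel_measurable borel" "h \<in> borel_measurable borel"
      unfolding f_def[abs_def] g_def[abs_def] h_def[abs_def] by measurable
    have "AE x in lborel. L2_borel (L2_of f :: 1 L2) x = f x"
      by (rule AE_L2_borel_L2_of, measurable, rule integrable_bounded_support[of _ "cmod c" 1])
        (auto simp: f_def indicator_def)
    from AE_plane_fst[OF this] have f: "AE (s, r::real) in lborel. L2_borel (L2_of f :: 1 L2) s = f s" .
    have "AE x in lborel. L2_borel (L2_of g :: 1 L2) x = g x"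
      by (rule AE_L2_borel_L2_of, measurable, rule integrable_bounded_support[of _ 1 1])
        (auto simp: g_def indicator_def)
    from AE_plane_snd[OF this] have g: "AE (s::real, r) in lborel. L2_borel (L2_of g :: 1 L2) r = g r" .
    have "AE x in lborel. L2_borel (L2_of h :: 2 L2) x = h x"
      by (rule AE_L2_borel_L2_of, measurable, rule integrable_bounded_support[of _ 1 2])
        (auto simp: h_def indicator_def)
    from AE_shear[OF AE_plane_snd[OF this], of 1]
    have h: "AE (s, r) in lborel. L2_borel (L2_of h :: 2 L2) (s + r) = h (s + r)" by simp
    have "c * ?I = (\<integral>z. c * (indicator (A \<times> B) z *\<^sub>R (case z of (s, r) \<Rightarrow> H s r)) \<partial>lborel)"
      by (subst integral_mult_right_zero) (simp add: lborel_prod)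
    also have "\<dots> = (\<integral>(s, r). H s r * L2_borel (L2_of f :: 1 L2) s * L2_borel (L2_of g :: 1 L2) r
        * cnj (L2_borel (L2_of h :: 2 L2) (s + r)) \<partial>lborel)"
    proof (rule integral_cong_AE)
      show "AE z in lborel. c * (indicator (A \<times> B) z *\<^sub>R (case z of (s, r) \<Rightarrow> H s r)) =
          (case z of (s, r) \<Rightarrow> H s r * L2_borel (L2_of f :: 1 L2) s * L2_borel (L2_of g :: 1 L2) r
            * cnj (L2_borel (L2_of h :: 2 L2) (s + r)))"
        using f g h
      proof eventually_elim
        case (elim z)
        obtain s r where z: "z = (s, r)" by (cases z)
        show ?case
        proof (cases "s \<in> {0..1} \<and> r \<in> {0..1}")
          case True
          then show ?thesis
            using elim by (auto simp: z f_def g_def h_def indicator_def)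
        next
          case False
          then have "H s r = 0" by (intro H_outside) auto
          then show ?thesis by (simp add: z)
        qed
      qed
    qed (unfold lborel_prod[symmetric], measurable)
    finally have "Re (c * ?I) = form (L2_of f) (L2_of g) (L2_of h)"
      by (simp add: form_def)
    then show ?thesis by (simp add: form)
  qed
  \<comment> \<open>The form sees only real parts; the factors \<open>1\<close> and
    \<open>-\<i>\<close> recover the real and the imaginary part of the integral.\<close>
  from Re0[of 1] Re0[of "-\<i>"] show ?thesis by (simp add: complex_eq_iff)
qed

text \<open>The integral of \<open>H\<close> vanishes over all rectangles, hence over all measurable
  sets by Dynkin's argument, and a density with this property is zero almost everywhere.\<close>

lemma AE_H_eq_0:
  assumes form: "\<And>u v \<phi>. form u v \<phi> = 0"
  shows "AE (s, r) in lborel. H s r = 0"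
proof -
  let ?M = "lborel \<Otimes>\<^sub>M lborel :: (real \<times> real) measure" and ?h = "\<lambda>(s, r). H s r"
  let ?G = "{A \<times> B | A B. A \<in> sets (lborel :: real measure) \<and> B \<in> sets (lborel :: real measure)}"
  have seti: "set_integrable ?M A ?h" if "A \<in> sets ?M" for A
    unfolding set_integrable_def using that integrable_H by (rule integrable_mult_indicator)
  have sets: "sets ?M = sigma_sets (space lborel \<times> space lborel) ?G"
    by (simp add: sets_pair_measure)
  have rect: "set_lebesgue_integral ?M (A \<times> B) ?h = 0" if "A \<in> sets borel" "B \<in> sets borel" for A B
    unfolding set_lebesgue_integral_def using integral_H_times[OF form that] .
  have zero: "set_lebesgue_integral ?M A ?h = 0" if "A \<in> sets ?M" for A
    using Int_stable_pair_measure_generator pair_measure_closed that[unfolded sets]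
  proof (induction rule: sigma_sets_induct_disjoint)
    case (basic A)
    then show ?case using rect by auto
  next
    case empty
    then show ?case by (simp add: set_lebesgue_integral_def)
  next
    case (compl A)
    then have A: "A \<in> sets ?M" by (simp only: sets)
    from sets.compl_sets[OF this] have A': "UNIV - A \<in> sets ?M" by (simp add: space_pair_measure)
    have "set_lebesgue_integral ?M (A \<union> (UNIV - A)) ?h
        = set_lebesgue_integral ?M A ?h + set_lebesgue_integral ?M (UNIV - A) ?h"
      using A A' by (intro set_integral_Un seti) auto
    \<comment> \<open>The whole plane is itself a rectangle, so the integral over it is already
      known to be 0.\<close>
    moreover have "A \<union> (UNIV - A) = UNIV \<times> UNIV" by auto
    ultimately show ?case using compl rect[of UNIV UNIV] by simp
  next
    case (union A)
    then have A: "A i \<in> sets ?M" for i by (auto simp only: sets)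
    have "set_lebesgue_integral ?M (\<Union>i. A i) ?h = (\<Sum>i. set_lebesgue_integral ?M (A i) ?h)"
      using A union(1) by (intro lebesgue_integral_countable_add seti) (auto simp: disjoint_family_on_def)
    with union show ?case by simp
  qed
  have "AE z in ?M. ?h z = 0"
    by (rule sigma_finite_measure.density_zero[OF lborel_pair.P.sigma_finite_measure_axioms integrable_H zero])
  then show ?thesis by (simp only: lborel_prod case_prod_unfold)
qed

end

text \<open>The norm of a self-adjoint operator is controlled by its quadratic form: polarisation of
  \<open>inner (T y) z\<close> and the parallelogram law.\<close>

lemma norm_le_of_quadratic_le:
  fixes T :: "'a::real_inner \<Rightarrow> 'a"
  assumes lin: "linear T" and sym: "\<And>x y. inner (T x) y = inner (T y) x"
    and q: "\<And>x. \<bar>inner (T x) x\<bar> \<le> (norm x)\<^sup>2"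
  shows "norm (T x) \<le> norm x"
proof (cases "norm (T x) = 0")
  case False
  define a b where "a = norm x" and "b = norm (T x)"
  have x0: "x \<noteq> 0" using False linear_0[OF lin] by auto
  then have ab: "a > 0" "b > 0" using False by (auto simp: a_def b_def)
  \<comment> \<open>This scaling gives \<open>y\<close> and \<open>z\<close> the same norm
    \<open>a * b\<close>, so that the parallelogram bound loses nothing.\<close>
  define y z where "y = b *\<^sub>R x" and "z = a *\<^sub>R T x"
  have "4 * inner (T y) z = inner (T (y + z)) (y + z) - inner (T (y - z)) (y - z)"
    using sym[of z y] by (simp add: linear_add[OF lin] linear_diff[OF lin] inner_simps)
  also have "\<dots> \<le> (norm (y + z))\<^sup>2 + (norm (y - z))\<^sup>2"
    using q[of "y + z"] q[of "y - z"] by linarith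
  also have "\<dots> = 2 * ((norm y)\<^sup>2 + (norm z)\<^sup>2)"
    by (simp add: power2_norm_eq_inner inner_simps)
  also have "\<dots> = 4 * (a * b)\<^sup>2"
    using ab by (simp add: y_def z_def a_def[symmetric] b_def[symmetric] power_mult_distrib)
  also have "inner (T y) z = a * b * b\<^sup>2"
    by (simp add: y_def z_def linear_scale[OF lin] b_def power2_norm_eq_inner)
  finally have "(a * b * b) * b \<le> (a * b * b) * a"
    by (simp add: power2_eq_square mult_ac)
  then have "b \<le> a" using ab by simp
  then show ?thesis by (simp add: a_def b_def)
qed simp

section \<open>Reduction to a Borel kernel\<close>

text \<open>Completeness of Lebesgue measure makes \<open>f\<close> measurable as soon as it agrees
  almost everywhere with \<open>g\<close>.\<close>

lemma integral_lebesgue_AE_borel: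
  fixes f :: "real \<Rightarrow> complex"
  assumes g: "g \<in> borel_measurable borel" and ae: "AE s in lborel. f s = g s"
  shows "(\<integral>s. f s \<partial>lebesgue) = (\<integral>s. g s \<partial>lborel)"
proof -
  have g': "g \<in> borel_measurable lebesgue"
    using g by (intro measurable_completion) simp
  have ae': "AE s in lebesgue. g s = f s"
    using AE_completion[OF ae] by eventually_elim simp
  have "(\<integral>s. f s \<partial>lebesgue) = (\<integral>s. g s \<partial>lebesgue)"
    using ae' by (intro integral_cong_AE borel_measurable_AE[OF g' ae'] g') (auto elim: eventually_mono)
  then show ?thesis using g by (simp add: integral_completion)
qed

text \<open>\<open>L2_of\<close> is meaningful only for square-integrable functions. The function
  \<open>f\<close>, in the uses below a raw integral from a definition, inherits measurability and
  integrability from \<open>g\<close>.\<close>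

lemma L2_of_cong_AE:
  assumes g: "g \<in> borel_measurable borel" "integrable lborel (\<lambda>x. (cmod (g x))\<^sup>2)"
    and out: "\<And>x. x \<notin> {0..real CARD('n)} \<Longrightarrow> g x = 0"
    and ae: "AE x in lborel. x \<in> {0..real CARD('n)} \<longrightarrow> f x = g x"
  shows "L2_of f = (L2_of g :: 'n L2)"
proof -
  let ?M = "L2_measure TYPE('n)"
  have sg: "sq_integrable ?M g" by (rule sq_integrable_L2_measureI[OF g out])
  have "(\<lambda>x. if x \<in> {0..real CARD('n)} then f x else 0) \<in> borel_measurable lebesgue"
  proof (rule borel_measurable_AE)
    show "g \<in> borel_measurable lebesgue" using g by (intro measurable_completion) simp
    show "AE x in lebesgue. g x = (if x \<in> {0..real CARD('n)} then f x else 0)"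
      using AE_completion[OF ae] by eventually_elim (use out in auto)
  qed
  then have mf: "f \<in> borel_measurable ?M"
    unfolding L2_measure_def by (subst borel_measurable_if[symmetric]) simp_all
  have ae': "AE x in ?M. g x = f x"
    unfolding AE_L2_measure using ae by eventually_elim simp
  have "integrable ?M (\<lambda>x. (cmod (f x))\<^sup>2)"
  proof (rule integrable_cong_AE_imp)
    show "integrable ?M (\<lambda>x. (cmod (g x))\<^sup>2)" using sg by (simp add: sq_integrable_def)
    show "(\<lambda>x. (cmod (f x))\<^sup>2) \<in> borel_measurable ?M" using mf by measurable
    show "AE x in ?M. (cmod (g x))\<^sup>2 = (cmod (f x))\<^sup>2" using ae' by eventually_elim simp
  qed
  then have sf: "sq_integrable ?M f" using mf by (simp add: sq_integrable_def)
  show ?thesis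
    using L2_of_eq_iff[OF sf sg] ae' by (auto elim: eventually_mono)
qed

text \<open>A Borel representative of \<open>k\<close> is truncated, sheared and symmetrised; each
  change affects only a null set of the region concerned.\<close>

lemma autoconv_kernel_square_kernel:
  assumes "autoconv_kernel k"
  obtains H C where "square_kernel H C"
    "AE (s, r) in lborel. s \<in> {0..1} \<and> r \<in> {0..1} \<longrightarrow> k s (s + r) = H s r"
proof -
  let ?S = "{0..1::real} \<times> {0..2::real}"
  have S: "?S \<in> sets lebesgue" by (intro sets_completionI_sets) (simp add: borel_closed closed_Times)
  have m: "(\<lambda>(s, t). k s t) \<in> borel_measurable (lebesgue_on ?S)"
    using assms by (simp add: autoconv_kernel_def)
  obtain C where bd: "AE (s, t) in lebesgue_on ?S. cmod (k s t) \<le> C"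
    using assms by (auto simp: autoconv_kernel_def)
  have sym: "AE (s, t) in lebesgue_on ?S. s \<le> t \<and> t \<le> s + 1 \<longrightarrow> k s t = k (t - s) t"
    using assms by (simp add: autoconv_kernel_def)
  have "(\<lambda>z. if z \<in> ?S then (case z of (s, t) \<Rightarrow> k s t) else 0) \<in> borel_measurable lebesgue"
    using m by (rule borel_measurable_if_I) (rule S)
  then obtain K where K [measurable]: "K \<in> borel_measurable borel"
    and Kk: "AE z in lborel. (if z \<in> ?S then (case z of (s, t) \<Rightarrow> k s t) else 0) = K z"
    by (rule lebesgue_ex_borel_representative)
  have K' [measurable]: "K \<in> borel_measurable (borel \<Otimes>\<^sub>M borel)"
    using K by (simp only: borel_prod)
  \<comment> \<open>Truncation turns the essential bound into a bound at every point.\<close>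
  define L where "L z = (if cmod (K z) \<le> C then K z else 0)" for z
  have L [measurable]: "L \<in> borel_measurable (borel \<Otimes>\<^sub>M borel)"
    unfolding L_def[abs_def] by measurable
  obtain M where M: "C \<le> M" "0 \<le> M" by (meson linear order_refl)
  have L_le: "cmod (L z) \<le> M" for z using M by (simp add: L_def)
  define P where "P s t \<longleftrightarrow> ((s, t) \<in> ?S \<longrightarrow>
      k s t = L (s, t) \<and> (s \<le> t \<and> t \<le> s + 1 \<longrightarrow> k s t = k (t - s) t))" for s t
  have "AE (s, t) in lborel. P s t"
    using Kk bd[unfolded AE_lebesgue_on_iff[OF S]] sym[unfolded AE_lebesgue_on_iff[OF S]]
    by eventually_elim (auto simp: P_def L_def split: if_splits)
  from AE_shear[OF this, of 1] have P1: "AE (s, r) in lborel. P s (s + r)" by simp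
  \<comment> \<open>The second term in the definition of \<open>H\<close> is \<open>L\<close> at
    \<open>(r, s + r)\<close>, so the same facts are needed with \<open>s\<close> and
    \<open>r\<close> exchanged.\<close>
  from AE_plane_swap[OF this] have P2: "AE (s, r) in lborel. P r (r + s)" .
  \<comment> \<open>The average is symmetric everywhere; where \<open>P\<close> holds at both
    points, its two terms coincide with \<open>k s (s + r)\<close>.\<close>
  define H where "H s r = (if s \<in> {0..1} \<and> r \<in> {0..1} then (L (s, s + r) + L (r, s + r)) / 2 else 0)" for s r
  show ?thesis
  proof (rule that)
    show "square_kernel H M"
    proof
      show "(\<lambda>(s, r). H s r) \<in> borel_measurable borel"
        unfolding H_def borel_prod[symmetric] by measurable
      show "cmod (H s r) \<le> M" for s r
        using norm_triangle_ineq[of "L (s, s + r)" "L (r, s + r)"] L_le[of "(s, s + r)"] L_le[of "(r, s + r)"] M(2)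
        by (simp add: H_def norm_divide)
    qed (auto simp: H_def add.commute)
    show "AE (s, r) in lborel. s \<in> {0..1} \<and> r \<in> {0..1} \<longrightarrow> k s (s + r) = H s r"
      using P1 P2
    proof eventually_elim
      case (elim z)
      obtain s r where z: "z = (s, r)" by (cases z)
      have "k s (s + r) = H s r" if "s \<in> {0..1}" "r \<in> {0..1}"
      proof -
        have "k s (s + r) = L (s, s + r)" "k s (s + r) = k r (s + r)"
          using elim that by (auto simp: z P_def)
        moreover have "k r (s + r) = L (r, s + r)"
          using elim that by (auto simp: z P_def add.commute)
        ultimately show ?thesis using that by (simp add: H_def)
      qed
      then show ?case by (simp add: z)
    qed
  qed
qed

section \<open>Autoconvolution and integral operator in terms of \<open>conv\<close> and
  \<open>adj\<close>\<close>

locale autoconv_square_kernel = square_kernel +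
  fixes k :: "real \<Rightarrow> real \<Rightarrow> complex"
  assumes AE_k_eq_H: "AE (s, r) in lborel. s \<in> {0..1} \<and> r \<in> {0..1} \<longrightarrow> k s (s + r) = H s r"
begin

text \<open>If \<open>s\<close> or \<open>t - s\<close> lies outside \<open>[0,1]\<close>, both
  integrands are 0; otherwise the a.e. identities, sheared back with \<open>c = -1\<close>, apply.
  Equality on almost all sections then equates the inner integrals for almost every
  \<open>t\<close>.\<close>

lemma autoconv_eq_conv: "autoconv k u = L2_of (conv u u)"
proof -
  let ?f = "\<lambda>s t. k s t * L2_fun u s * L2_fun u (t - s)"
    and ?g = "\<lambda>s t. H s (t - s) * L2_borel u s * L2_borel u (t - s)"
  have "AE (s, t) in lborel. L2_fun u (t - s) = L2_borel u (t - s)"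
    using AE_shear[OF AE_plane_snd[OF AE_L2_borel[of u]], of "-1"] by simp
  moreover have "AE (s, t) in lborel. s \<in> {0..1} \<and> t - s \<in> {0..1} \<longrightarrow> k s t = H s (t - s)"
    using AE_shear[OF AE_k_eq_H, of "-1"] by simp
  moreover have "AE (s, t::real) in lborel. L2_fun u s = L2_borel u s"
    using AE_plane_fst[OF AE_L2_borel[of u]] .
  ultimately have "AE (s, t) in lborel. ?f s t = ?g s t"
  proof eventually_elim
    case (elim z)
    obtain s t where z: "z = (s, t)" by (cases z)
    show ?case
    proof (cases "s \<in> {0..1} \<and> t - s \<in> {0..1}")
      case False
      then show ?thesis by (auto simp: z L2_fun_def H_outside)
    qed (use elim in \<open>simp add: z\<close>)
  qed
  then have "AE t in lborel. AE s in lborel. ?f s t = ?g s t"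
    by (rule AE_plane_sections)
  then have "AE t in lborel. (\<integral>s. ?f s t \<partial>lebesgue) = conv u u t"
  proof eventually_elim
    case (elim t)
    show ?case
      unfolding conv_def by (rule integral_lebesgue_AE_borel[OF _ elim]) measurable
  qed
  then show ?thesis
    unfolding autoconv_def
    by (intro L2_of_cong_AE conv_square_integrable) (auto elim: eventually_mono)
qed

text \<open>The integrands are compared only for \<open>r\<close> in \<open>[0,1]\<close>, where
  \<open>H\<close> represents \<open>k\<close>; classes in \<open>1 L2\<close> depend on nothing
  else.\<close>

lemma Phi_adj_I_eq_adj: "Phi (adj_I k \<phi>) u = L2_of (adj \<phi> u)"
proof -
  let ?f = "\<lambda>s r. indicator {0..1} s *\<^sub>R (adj_I k \<phi> s r * cnj (L2_fun u s))"
    and ?g = "\<lambda>s r. cnj (H s r) * L2_borel \<phi> (s + r) * cnj (L2_borel u s)"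
  have "AE (s, r) in lborel. L2_fun \<phi> (s + r) = L2_borel \<phi> (s + r)"
    using AE_shear[OF AE_plane_snd[OF AE_L2_borel[of \<phi>]], of 1] by simp
  moreover have "AE (s, r::real) in lborel. L2_fun u s = L2_borel u s"
    using AE_plane_fst[OF AE_L2_borel[of u]] .
  ultimately have "AE (s, r) in lborel. r \<in> {0..1} \<longrightarrow> ?f s r = ?g s r"
    using AE_k_eq_H
  proof eventually_elim
    case (elim z)
    obtain s r where z: "z = (s, r)" by (cases z)
    show ?case
    proof (cases "s \<in> {0..1}")
      case False
      then show ?thesis by (auto simp: z H_outside)
    qed (use elim in \<open>auto simp: z adj_I_def\<close>)
  qed
  then have "AE r in lborel. AE s in lborel. r \<in> {0..1} \<longrightarrow> ?f s r = ?g s r"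
    by (rule AE_plane_sections)
  then have "AE r in lborel. r \<in> {0..1} \<longrightarrow> (\<integral>s. ?f s r \<partial>lebesgue) = adj \<phi> u r"
  proof eventually_elim
    case (elim r)
    show ?case
    proof
      assume "r \<in> {0..1}"
      with elim have "AE s in lborel. ?f s r = ?g s r" by simp
      then show "(\<integral>s. ?f s r \<partial>lebesgue) = adj \<phi> u r"
        unfolding adj_def by (intro integral_lebesgue_AE_borel) measurable
    qed
  qed
  then show ?thesis
    unfolding Phi_def set_lebesgue_integral_def
    by (intro L2_of_cong_AE adj_square_integrable) simp_all
qed

section \<open>The source condition as a bound on the quadratic form\<close>

lemma dilinear_subdifferential_iff:
  "(0, dual_adjoint (dilinear_lift (autoconv k)) \<psi>) \<in> \<partial>\<^sub>\<beta> (\<lambda>v. ereal ((norm v)\<^sup>2)) u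
    \<longleftrightarrow> (\<forall>v. (norm u)\<^sup>2 - form u u \<psi> \<le> (norm v)\<^sup>2 - form v v \<psi>)"
proof -
  have "blinfun_apply (dilinear_lift (autoconv k)) (tensor_sq v) = L2_of (conv v v)" for v
    using dilinear_lift_tensor_sq[OF bounded_bilinear_conv, of v] by (simp add: autoconv_eq_conv[abs_def])
  then have "blinfun_apply (dual_adjoint (dilinear_lift (autoconv k)) \<psi>) (tensor_sq v) = form v v \<psi>" for v
    by (simp add: dual_adjoint_def inner_commute[of \<psi>] inner_conv)
  then show ?thesis
    by (auto simp: dilinear_subdifferential_def blinfun.diff_right algebra_simps)
qed

text \<open>The difference \<open>?Q\<close> is homogeneous of degree two, so a minimum can only be
  attained with value 0.\<close>

lemma form_ge_minimum_iff:
  "(\<forall>v. (norm u)\<^sup>2 - form u u \<psi> \<le> (norm v)\<^sup>2 - form v v \<psi>)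
    \<longleftrightarrow> (\<forall>v. form v v \<psi> \<le> (norm v)\<^sup>2) \<and> form u u \<psi> = (norm u)\<^sup>2"
proof
  let ?Q = "\<lambda>v. (norm v)\<^sup>2 - form v v \<psi>"
  have Q: "?Q (c *\<^sub>R v) = c\<^sup>2 * ?Q v" for c v
    by (simp add: form_linear power_mult_distrib power2_eq_square algebra_simps)
  assume min: "\<forall>v. ?Q u \<le> ?Q v"
  \<comment> \<open>Comparison with \<open>0\<close> and with \<open>2 *\<^sub>R u\<close>; the
    second excludes negative values.\<close>
  have "?Q u \<le> 0" "?Q u \<le> 4 * ?Q u"
    using min[rule_format, of "0 *\<^sub>R u"] min[rule_format, of "2 *\<^sub>R u"] unfolding Q by simp_all
  moreover have "q = 0" if "q \<le> 0" "q \<le> 4 * q" for q :: real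
    using that by linarith
  ultimately have "?Q u = 0" by blast
  with min show "(\<forall>v. form v v \<psi> \<le> (norm v)\<^sup>2) \<and> form u u \<psi> = (norm u)\<^sup>2" by simp
qed auto

text \<open>The hypothesis at \<open>rot x\<close> supplies the missing lower bound on the quadratic
  form of the self-adjoint operator.\<close>

lemma norm_adj_le:
  assumes q: "\<And>v. form v v \<psi> \<le> (norm v)\<^sup>2"
  shows "norm (L2_of (adj \<psi> v) :: 1 L2) \<le> norm v"
proof (rule norm_le_of_quadratic_le[where T="\<lambda>v. L2_of (adj \<psi> v)"])
  show "linear (\<lambda>v. L2_of (adj \<psi> v) :: 1 L2)"
    by (rule bounded_linear.linear[OF bounded_linear_adj])
  show "inner (L2_of (adj \<psi> x)) y = inner (L2_of (adj \<psi> y)) x" for x y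
    by (simp only: inner_adj form_commute[of x y])
  show "\<bar>inner (L2_of (adj \<psi> x)) x\<bar> \<le> (norm x)\<^sup>2" for x
    using q[of x] q[of "rot x"] by (simp add: inner_adj form_rot norm_rot)
qed

text \<open>Equality case of Cauchy-Schwarz: expanding the square of \<open>norm (?w - u)\<close>
  and using \<open>norm ?w \<le> norm u\<close> leaves at most \<open>n - 2 * n + n = 0\<close>,
  with \<open>n\<close> the square of \<open>norm u\<close>.\<close>

lemma adj_eq_self:
  assumes q: "\<And>v. form v v \<psi> \<le> (norm v)\<^sup>2" and u: "form u u \<psi> = (norm u)\<^sup>2"
  shows "L2_of (adj \<psi> u) = u"
proof -
  let ?w = "L2_of (adj \<psi> u) :: 1 L2"
  have "(norm (?w - u))\<^sup>2 = (norm ?w)\<^sup>2 - 2 * form u u \<psi> + (norm u)\<^sup>2"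
    unfolding inner_adj[symmetric] power2_norm_eq_inner by (simp add: inner_simps inner_commute)
  also have "\<dots> \<le> 0"
    using norm_adj_le[OF q, of u] u power_mono[of "norm ?w" "norm u" 2] by simp
  finally show ?thesis by simp
qed

text \<open>A nonzero kernel yields a nonzero operator for some \<open>\<phi>\<close>; rescaling
  \<open>\<phi>\<close> normalises it, as \<open>adj\<close> is real-linear in
  \<open>\<phi>\<close>.\<close>

lemma ex_onorm_adj_eq_1:
  assumes nz: "\<not> (AE (s, r) in lborel. H s r = 0)"
  obtains \<phi> where "onorm (\<lambda>u. L2_of (adj \<phi> u) :: 1 L2) = 1"
proof -
  have "\<exists>u v \<phi>. form u v \<phi> \<noteq> 0"
    using AE_H_eq_0 nz by blast
  then obtain u \<phi> where "L2_of (adj \<phi> u) \<noteq> (0 :: 1 L2)"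
    by (metis inner_adj inner_zero_left)
  then have pos: "onorm (\<lambda>u. L2_of (adj \<phi> u) :: 1 L2) > 0" (is "?N > 0")
    using onorm_pos_lt[OF bounded_linear_adj] by blast
  have "onorm (\<lambda>u. L2_of (adj ((1 / ?N) *\<^sub>R \<phi>) u) :: 1 L2) = 1"
    using pos by (simp add: adj_scaleR onorm_scaleR[OF bounded_linear_adj] del: scaleR_scaleR)
  then show ?thesis by (rule that)
qed

text \<open>\<open>H\<close> determines \<open>k\<close> on the strip
  \<open>s \<le> t \<le> s + 1\<close>; off the strip the support condition gives
  \<open>k s t = 0\<close>.\<close>

lemma not_AE_H_eq_0:
  assumes kernel: "autoconv_kernel k"
    and nonzero: "\<not> (AE (s, t) in lebesgue_on ({0..1} \<times> {0..2}). k s t = 0)"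
  shows "\<not> (AE (s, r) in lborel. H s r = 0)"
proof
  have S: "{0..1::real} \<times> {0..2::real} \<in> sets lebesgue"
    by (intro sets_completionI_sets) (simp add: borel_closed closed_Times)
  assume "AE (s, r) in lborel. H s r = 0"
  with AE_k_eq_H have "AE (s, r) in lborel. s \<in> {0..1} \<and> r \<in> {0..1} \<longrightarrow> k s (s + r) = 0"
    by eventually_elim auto
  from AE_shear[OF this, of "-1"]
  have "AE (s, t) in lborel. s \<in> {0..1} \<and> t - s \<in> {0..1} \<longrightarrow> k s t = 0" by simp
  moreover have "AE (s, t) in lebesgue_on ({0..1} \<times> {0..2}). \<not> (s \<le> t \<and> t \<le> s + 1) \<longrightarrow> k s t = 0"
    using kernel by (simp add: autoconv_kernel_def)
  ultimately have "AE (s, t) in lebesgue_on ({0..1} \<times> {0..2}). k s t = 0"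
    unfolding AE_lebesgue_on_iff[OF S] by eventually_elim auto
  with nonzero show False ..
qed

end

text \<open>The assumption \<open>nonzero\<close> excludes the zero kernel: there every
  \<open>Phi (adj_I k \<phi>)\<close> is zero and has norm 0, while \<open>u = 0\<close> satisfies
  the source condition.\<close>

theorem theorem5p11:
  fixes k :: "real \<Rightarrow> real \<Rightarrow> complex" and g :: "2 L2" and u :: "1 L2"
  assumes kernel: "autoconv_kernel k"
    and nonzero: "\<not> (AE (s, t) in lebesgue_on ({0..1} \<times> {0..2}). k s t = 0)"
    and solution: "min_norm_solution (autoconv k) g u"
  shows "(\<exists>\<psi> :: 2 L2. (0, dual_adjoint (dilinear_lift (autoconv k)) \<psi>)
             \<in> \<partial>\<^sub>\<beta> (\<lambda>v. ereal ((norm v)\<^sup>2)) u)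
     \<longleftrightarrow> (\<exists>\<phi> :: 2 L2. onorm (Phi (adj_I k \<phi>)) = 1 \<and> Phi (adj_I k \<phi>) u = u)"
proof -
  obtain H C where "square_kernel H C"
    and ae: "AE (s, r) in lborel. s \<in> {0..1} \<and> r \<in> {0..1} \<longrightarrow> k s (s + r) = H s r"
    by (rule autoconv_kernel_square_kernel[OF kernel])
  then interpret square_kernel H C by simp
  interpret autoconv_square_kernel H C k
    by unfold_locales (rule ae)
  let ?T = "\<lambda>\<phi> u. L2_of (adj \<phi> u) :: 1 L2"
  have "(\<exists>\<psi>. (\<forall>v. form v v \<psi> \<le> (norm v)\<^sup>2) \<and> form u u \<psi> = (norm u)\<^sup>2)
    \<longleftrightarrow> (\<exists>\<phi>. onorm (?T \<phi>) = 1 \<and> ?T \<phi> u = u)"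
  proof
    assume "\<exists>\<psi>. (\<forall>v. form v v \<psi> \<le> (norm v)\<^sup>2) \<and> form u u \<psi> = (norm u)\<^sup>2"
    then obtain \<psi> where q: "\<And>v. form v v \<psi> \<le> (norm v)\<^sup>2" and u: "form u u \<psi> = (norm u)\<^sup>2"
      by blast
    show "\<exists>\<phi>. onorm (?T \<phi>) = 1 \<and> ?T \<phi> u = u"
    \<comment> \<open>Every operator fixes \<open>0\<close>, so in that case only the norm has to be
      arranged.\<close>
    proof (cases "u = 0")
      case True
      obtain \<phi> where "onorm (?T \<phi>) = 1"
        by (rule ex_onorm_adj_eq_1[OF not_AE_H_eq_0[OF kernel nonzero]])
      then show ?thesis
        using True bounded_linear_adj[of \<phi>, THEN linear_simps(3)] by auto
    next
      case False
      have Tu: "?T \<psi> u = u" by (rule adj_eq_self[OF q u])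
      have "onorm (?T \<psi>) \<le> 1"
        using norm_adj_le[OF q] by (intro onorm_bound) simp_all
      \<comment> \<open>A nonzero fixed vector forces the operator norm to be at least 1.\<close>
      moreover have "norm u \<le> onorm (?T \<psi>) * norm u"
        using onorm[OF bounded_linear_adj, of \<psi> u] Tu by simp
      ultimately have "onorm (?T \<psi>) = 1" using False by simp
      with Tu show ?thesis by blast
    qed
  next
    assume "\<exists>\<phi>. onorm (?T \<phi>) = 1 \<and> ?T \<phi> u = u"
    then obtain \<phi> where \<phi>: "onorm (?T \<phi>) = 1" "?T \<phi> u = u" by blast
    have "form v v \<phi> \<le> (norm v)\<^sup>2" for v
    proof -
      \<comment> \<open>Cauchy-Schwarz turns the operator norm 1 into the required bound on the
        quadratic form.\<close>
      have "form v v \<phi> \<le> norm (?T \<phi> v) * norm v"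
        unfolding inner_adj[symmetric] by (rule norm_cauchy_schwarz)
      also have "\<dots> \<le> norm v * norm v"
        using onorm[OF bounded_linear_adj, of \<phi> v] \<phi>(1) by (intro mult_right_mono) simp_all
      finally show ?thesis by (simp add: power2_eq_square)
    qed
    moreover have "form u u \<phi> = (norm u)\<^sup>2"
      unfolding inner_adj[symmetric] \<phi>(2) by (simp add: power2_norm_eq_inner)
    ultimately show "\<exists>\<psi>. (\<forall>v. form v v \<psi> \<le> (norm v)\<^sup>2) \<and> form u u \<psi> = (norm u)\<^sup>2" by blast
  qed
  then show ?thesis
    unfolding dilinear_subdifferential_iff form_ge_minimum_iff Phi_adj_I_eq_adj[abs_def] .
qed

end
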